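(* The following decision problem belongs to $\mathbf{NP}$. Input: words $c_1,\dots,c_k$ in the alphabet $\{a^{\pm1},t^{\pm1}\}$. Question: do there exist $x,z_1,\dots,z_k\in L_2$ such that $x^2\prod_{i=1}^k z_i^{-1}c_iz_i=1$ in $L_2$? (That is, the Diophantine problem for non-orientable quadratic equations of genus one over the lamplighter group $L_2$ belongs to $\mathbf{NP}$.)
   Context: Let $\mathbb{Z}_2^{\mathbb{Z}}$ denote the abelian group of finitely supported functions $f:\mathbb{Z}\to\mathbb{Z}_2$ under pointwise addition, and for $b\in\mathbb{Z}$ put $f^b(x)=f(x+b)$. The lamplighter group is $L_2=\mathbb{Z}\ltimes\mathbb{Z}_2^{\mathbb{Z}}$, the set of pairs $(\delta,f)$ with product $(\delta_1,f_1)(\delta_2,f_2)=(\delta_1+\delta_2,\,f_1^{\delta_2}+f_2)$. It is generated by $a=(0,\mathbf 1_0)$, where $\mathbf 1_0$ is the indicator function of $\{0\}$, and $t=(1,0)$. Elements of $L_2$ are given as words in $a^{\pm1},t^{\pm1}$; the input size is the length of the left-hand side of the equation. *)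

theory Defs
  imports "HOL-Algebra.Group" "HOL-Library.Z2" "HOL-Computational_Algebra.Polynomial"
begin

section \<open>The lamplighter group\<close>

definition lamplighter :: "(int \<times> (int \<Rightarrow> bit)) monoid" where
  "lamplighter =
    \<lparr>carrier = {(d, f). finite {x. f x \<noteq> 0}},
     monoid.mult = (\<lambda>(d1, f1) (d2, f2). (d1 + d2, \<lambda>x. f1 (x + d2) + f2 x)),
     one = (0, \<lambda>_. 0)\<rparr>"

lemma finite_support_shift:
  fixes f :: "int \<Rightarrow> bit"
  assumes "finite {x. f x \<noteq> 0}"
  shows "finite {x. f (x + d) \<noteq> 0}"
proof -
  have "{x. f (x + d) \<noteq> 0} = (\<lambda>x. x - d) ` {x. f x \<noteq> 0}"
    by (force simp: image_iff)
  with assms show ?thesis by simp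
qed

lemma finite_support_add:
  fixes f g :: "int \<Rightarrow> bit"
  assumes "finite {x. f x \<noteq> 0}" "finite {x. g x \<noteq> 0}"
  shows "finite {x. f x + g x \<noteq> 0}"
  by (rule finite_subset[OF _ finite_UnI[OF assms]]) auto

lemma group_lamplighter: "group lamplighter"
proof (rule groupI)
  fix x y assume xy: "x \<in> carrier lamplighter" "y \<in> carrier lamplighter"
  obtain d1 f1 d2 f2 where "x = (d1, f1)" "y = (d2, f2)"
    by (cases x; cases y)
  with xy finite_support_add[OF finite_support_shift, of f1 f2 d2]
  show "x \<otimes>\<^bsub>lamplighter\<^esub> y \<in> carrier lamplighter"
    by (simp add: lamplighter_def del: add_bit_eq_xor)
next
  show "\<one>\<^bsub>lamplighter\<^esub> \<in> carrier lamplighter"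
    by (simp add: lamplighter_def)
next
  fix x y z
  show "x \<otimes>\<^bsub>lamplighter\<^esub> y \<otimes>\<^bsub>lamplighter\<^esub> z = x \<otimes>\<^bsub>lamplighter\<^esub> (y \<otimes>\<^bsub>lamplighter\<^esub> z)"
    by (cases x; cases y; cases z)
       (simp add: lamplighter_def add_ac del: add_bit_eq_xor)
next
  fix x
  show "\<one>\<^bsub>lamplighter\<^esub> \<otimes>\<^bsub>lamplighter\<^esub> x = x"
    by (cases x) (simp add: lamplighter_def fun_eq_iff)
next
  fix x assume x: "x \<in> carrier lamplighter"
  obtain d f where df: "x = (d, f)" by (cases x)
  have "finite {y. f (y + (- d)) \<noteq> 0}"
    using x by (intro finite_support_shift) (simp add: df lamplighter_def)
  then have "(- d, \<lambda>y. f (y - d)) \<in> carrier lamplighter"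
    by (simp add: lamplighter_def)
  moreover have "(- d, \<lambda>y. f (y - d)) \<otimes>\<^bsub>lamplighter\<^esub> x = \<one>\<^bsub>lamplighter\<^esub>"
    by (simp add: df lamplighter_def fun_eq_iff)
  ultimately show "\<exists>y\<in>carrier lamplighter. y \<otimes>\<^bsub>lamplighter\<^esub> x = \<one>\<^bsub>lamplighter\<^esub>"
    by blast
qed

definition lamp_a :: "int \<times> (int \<Rightarrow> bit)" where
  "lamp_a = (0, \<lambda>x. if x = 0 then 1 else 0)"

definition lamp_t :: "int \<times> (int \<Rightarrow> bit)" where
  "lamp_t = (1, \<lambda>_. 0)"

datatype letter = Pos_a | Neg_a | Pos_t | Neg_t

instance letter :: finite
proof
  have "(UNIV :: letter set) = {Pos_a, Neg_a, Pos_t, Neg_t}"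
    using letter.exhaust by auto
  then show "finite (UNIV :: letter set)"
    by (metis finite.emptyI finite.insertI)
qed

fun letter_value :: "letter \<Rightarrow> int \<times> (int \<Rightarrow> bit)" where
  "letter_value Pos_a = lamp_a"
| "letter_value Neg_a = inv\<^bsub>lamplighter\<^esub> lamp_a"
| "letter_value Pos_t = lamp_t"
| "letter_value Neg_t = inv\<^bsub>lamplighter\<^esub> lamp_t"

definition list_product :: "('g, 'm) monoid_scheme \<Rightarrow> 'g list \<Rightarrow> 'g" where
  "list_product G gs = foldr (monoid.mult G) gs \<one>\<^bsub>G\<^esub>"

definition word_value :: "letter list \<Rightarrow> int \<times> (int \<Rightarrow> bit)" where
  "word_value w = list_product lamplighter (map letter_value w)"

text \<open>
  An instance \<open>c\<^sub>1, \<dots>, c\<^sub>k\<close> is written down as \<open>c\<^sub>1 # c\<^sub>2 # \<dots> c\<^sub>k #\<close>, where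
  \<^const>\<open>None\<close> plays the role of the delimiter \<open>#\<close>. This encoding is injective, and its
  length \<open>\<Sum>i. (\<bar>c\<^sub>i\<bar> + 1)\<close> agrees up to a constant factor and an additive constant with
  the length \<open>2 + \<Sum>i. (\<bar>c\<^sub>i\<bar> + 2)\<close> of the left-hand side of the equation.
\<close>

definition encode_words :: "letter list list \<Rightarrow> letter option list" where
  "encode_words cs = concat (map (\<lambda>c. map Some c @ [None]) cs)"

section \<open>Deterministic multitape Turing machines\<close>

text \<open>
  Since HOL cannot quantify existentially over types, states and auxiliary tape symbols
  are natural numbers below a bound fixed by the machine.
\<close>

datatype 'a symbol = Blank | Inp 'a | Aux nat

datatype move = Move_left | Stay | Move_right

record 'a tm =
  num_tapes :: nat
  num_states :: nat
  num_aux :: nat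
  start_state :: nat
  accept_state :: nat
  reject_state :: nat
  delta :: "nat \<Rightarrow> 'a symbol list \<Rightarrow> nat \<times> ('a symbol \<times> move) list"

definition tape_alphabet :: "'a tm \<Rightarrow> 'a symbol set" where
  "tape_alphabet M = {Blank} \<union> range Inp \<union> Aux ` {..<num_aux M}"

definition wf_tm :: "'a tm \<Rightarrow> bool" where
  "wf_tm M \<longleftrightarrow>
    num_tapes M \<ge> 2 \<and>
    start_state M < num_states M \<and>
    accept_state M < num_states M \<and>
    reject_state M < num_states M \<and>
    accept_state M \<noteq> reject_state M \<and>
    (\<forall>q < num_states M. \<forall>ss. length ss = num_tapes M \<and> set ss \<subseteq> tape_alphabet M \<longrightarrow>
      (let (q', acts) = delta M q ss in
        q' < num_states M \<and> length acts = num_tapes M \<and>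
        fst ` set acts \<subseteq> tape_alphabet M))"

text \<open>A tape is infinite in both directions; the second component is the head position.\<close>

type_synonym 'a tape = "(int \<Rightarrow> 'a symbol) \<times> int"

type_synonym 'a config = "nat \<times> 'a tape list"

fun move_offset :: "move \<Rightarrow> int" where
  "move_offset Move_left = -1"
| "move_offset Stay = 0"
| "move_offset Move_right = 1"

definition read_tape :: "'a tape \<Rightarrow> 'a symbol" where
  "read_tape tp = fst tp (snd tp)"

fun act_tape :: "'a tape \<Rightarrow> 'a symbol \<times> move \<Rightarrow> 'a tape" where
  "act_tape (c, h) (s, m) = (c(h := s), h + move_offset m)"

definition halted :: "'a tm \<Rightarrow> 'a config \<Rightarrow> bool" where
  "halted M cfg \<longleftrightarrow> fst cfg = accept_state M \<or> fst cfg = reject_state M"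

definition tm_step :: "'a tm \<Rightarrow> 'a config \<Rightarrow> 'a config" where
  "tm_step M cfg =
    (if halted M cfg then cfg
     else let (q', acts) = delta M (fst cfg) (map read_tape (snd cfg))
          in (q', map2 act_tape (snd cfg) acts))"

definition tape_of :: "'a symbol list \<Rightarrow> 'a tape" where
  "tape_of ss = (\<lambda>i. if 0 \<le> i \<and> nat i < length ss then ss ! nat i else Blank, 0)"

text \<open>The input is a pair of strings, presented on the first two tapes.\<close>

definition initial_config :: "'a tm \<Rightarrow> 'a list \<Rightarrow> 'a symbol list \<Rightarrow> 'a config" where
  "initial_config M w u =
    (start_state M,
     tape_of (map Inp w) # tape_of u # replicate (num_tapes M - 2) (tape_of []))"

definition tm_run :: "'a tm \<Rightarrow> 'a list \<Rightarrow> 'a symbol list \<Rightarrow> nat \<Rightarrow> 'a config" where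
  "tm_run M w u n = (tm_step M ^^ n) (initial_config M w u)"

definition tm_accepts :: "'a tm \<Rightarrow> 'a list \<Rightarrow> 'a symbol list \<Rightarrow> bool" where
  "tm_accepts M w u \<longleftrightarrow> (\<exists>n. fst (tm_run M w u n) = accept_state M)"

section \<open>The class NP\<close>

definition certificates :: "'a tm \<Rightarrow> 'a symbol list set" where
  "certificates M = lists (tape_alphabet M - {Blank})"

text \<open>
  Polynomial-time verifiers with certificates of polynomial length. The class constraint
  makes every language considered a language over a finite alphabet.
\<close>

definition NP :: "'a::finite list set set" where
  "NP = {L. \<exists>(M :: 'a tm) (p :: nat poly) (r :: nat poly).
      wf_tm M \<and>
      (\<forall>w. \<forall>u \<in> certificates M. halted M (tm_run M w u (poly r (length w + length u)))) \<and>
      (\<forall>w. w \<in> L \<longleftrightarrow>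
        (\<exists>u \<in> certificates M. length u \<le> poly p (length w) \<and> tm_accepts M w u))}"

end

theory Submission
  imports Defs "HOL-Library.Function_Algebras"
begin

text \<open>
  Write the \<open>i\<close>-th word as \<open>(d\<^sub>i, f\<^sub>i)\<close> and view lamp configurations as Laurent polynomials in \<open>T\<close> over the
  field with two elements. The equation is solvable iff \<open>\<Sum>d\<^sub>i\<close> is even and some sum
  \<open>\<Sum>T^e\<^sub>i f\<^sub>i\<close> lies in the ideal generated by all \<open>1 + T^d\<^sub>i\<close> and \<open>1 + T^d\<close>, where \<open>d\<close> is half
  of \<open>\<Sum>d\<^sub>i\<close>. If some \<open>d\<^sub>j\<close> is nonzero, then all exponents can be reduced modulo \<open>d\<^sub>j\<close>, except
  those of the cofactor of \<open>1 + T^d\<^sub>j\<close>, whose support is then bounded as well. If all \<open>d\<^sub>i\<close> vanish,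
  then large gaps between the \<open>e\<^sub>i\<close> can be closed. So exponents of quadratic size suffice.

  The certificate is a list of commands that steers a machine with a tape of lamps. One pass over
  the input adds up the \<open>T^e\<^sub>i f\<^sub>i\<close>. Every further pass toggles two lamps whose distance it
  measures by walking along the words, at half speed in the case of \<open>d\<close>. A counter of the lit lamps
  tells whether all of them are off in the end. Each step consumes a command, so the running
  time is bounded by the length of the certificate.
\<close>

declare add_bit_eq_xor [simp del] plus_fun_apply [simp del] zero_fun_apply [simp del]

lemmas pointwise = fun_eq_iff plus_fun_apply zero_fun_apply

section \<open>Lamp configurations\<close>

type_synonym lamps = "int \<Rightarrow> bit"

definition lit :: "lamps \<Rightarrow> int set" where
  "lit F = {x. F x \<noteq> 0}"

definition lamp :: "int \<Rightarrow> lamps" where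
  "lamp p = (\<lambda>x. if x = p then 1 else 0)"

definition shift :: "int \<Rightarrow> lamps \<Rightarrow> lamps" where
  "shift e F = (\<lambda>x. F (x - e))"

lemma bit_add_self: "(a :: bit) + a = 0"
  by (cases a) simp_all

lemma lamps_add_self [simp]: "(F :: lamps) + F = 0"
  by (simp add: pointwise bit_add_self)

lemma lamps_add_self_left [simp]: "(F :: lamps) + (F + G) = G"
  by (simp flip: add.assoc)

lemma lamps_add_eq_0_iff: "(F :: lamps) + G = 0 \<longleftrightarrow> F = G"
  by (metis add.right_neutral lamps_add_self lamps_add_self_left)

lemma in_lit_iff: "x \<in> lit F \<longleftrightarrow> F x = 1"
  by (simp add: lit_def)

lemma not_in_lit_iff: "x \<notin> lit F \<longleftrightarrow> F x = 0"
  by (simp add: lit_def)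

lemma lit_0 [simp]: "lit 0 = {}"
  by (simp add: lit_def zero_fun_apply)

lemma lit_lamp [simp]: "lit (lamp p) = {p}"
  by (auto simp: lit_def lamp_def)

lemma lit_eq_empty_iff: "lit F = {} \<longleftrightarrow> F = 0"
  by (auto simp: lit_def pointwise)

lemma lit_add_subset: "lit (F + G) \<subseteq> lit F \<union> lit G"
  by (auto simp: lit_def plus_fun_apply)

lemma lit_toggle_on: "p \<notin> lit F \<Longrightarrow> lit (F + lamp p) = insert p (lit F)"
  by (auto simp: lit_def lamp_def plus_fun_apply split: if_splits)

lemma lit_toggle_off: "p \<in> lit F \<Longrightarrow> lit (F + lamp p) = lit F - {p}"
  by (auto simp: lit_def lamp_def plus_fun_apply split: if_splits)

lemma finite_lit_add: "finite (lit F) \<Longrightarrow> finite (lit G) \<Longrightarrow> finite (lit (F + G))"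
  by (rule finite_subset[OF lit_add_subset]) simp

lemma lit_shift: "lit (shift e F) = (\<lambda>x. x + e) ` lit F"
proof -
  have "x \<in> (\<lambda>x. x + e) ` lit F" if "F (x - e) = 1" for x
    using that by (intro image_eqI[of _ _ "x - e"]) (simp_all add: lit_def)
  then show ?thesis
    by (auto simp: lit_def shift_def)
qed

lemma finite_lit_shift: "finite (lit F) \<Longrightarrow> finite (lit (shift e F))"
  by (simp add: lit_shift)

lemma shift_0 [simp]: "shift e 0 = 0" "shift 0 F = F"
  by (simp_all add: shift_def pointwise)

lemma shift_add: "shift e (F + G) = shift e F + shift e G"
  by (simp add: shift_def pointwise)

lemma shift_shift [simp]: "shift e (shift d F) = shift (e + d) F"
  by (simp add: shift_def pointwise algebra_simps)

lemma shift_lamp [simp]: "shift e (lamp p) = lamp (p + e)"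
  by (auto simp: shift_def lamp_def pointwise)

lemma shift_sum: "shift e (\<Sum>i\<in>I. F i) = (\<Sum>i\<in>I. shift e (F i))"
  by (induction I rule: infinite_finite_induct) (simp_all add: shift_add)

lemma finite_lit_induct [consumes 1, case_names zero toggle]:
  assumes "finite (lit F)" and "P 0"
    and "\<And>F p. finite (lit F) \<Longrightarrow> p \<notin> lit F \<Longrightarrow> P F \<Longrightarrow> P (F + lamp p)"
  shows "P F"
  using assms(1)
proof (induction "lit F" arbitrary: F rule: finite_psubset_induct)
  case psubset
  show ?case
  proof (cases "lit F = {}")
    case True
    then show ?thesis using assms(2) by (simp add: lit_eq_empty_iff)
  next
    case False
    then obtain p where p: "p \<in> lit F" by auto
    have lit': "lit (F + lamp p) = lit F - {p}"
      using p by (rule lit_toggle_off)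
    have "P (F + lamp p)"
      using p psubset by (intro psubset.hyps(2)) (auto simp: lit')
    with psubset.hyps(1) have "P ((F + lamp p) + lamp p)"
      using assms(3)[of "F + lamp p" p] by (simp add: lit')
    then show ?thesis by (simp add: add.assoc)
  qed
qed

section \<open>Sums of pairs of lamps at prescribed distances\<close>

text \<open>For \<open>A = UNIV\<close> this is the ideal generated by all 1 + T^d with d in
  \<open>D\<close>; a general \<open>A\<close> limits where generators may be placed, which later
  bounds the walks of the verifier.\<close>

inductive_set pair_span :: "int set \<Rightarrow> int set \<Rightarrow> lamps set" for A D where
  zero: "0 \<in> pair_span A D"
| step: "F \<in> pair_span A D \<Longrightarrow> p \<in> A \<Longrightarrow> d \<in> D \<Longrightarrow> F + (lamp p + lamp (p + d)) \<in> pair_span A D"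

lemma pair_in_span: "p \<in> A \<Longrightarrow> d \<in> D \<Longrightarrow> lamp p + lamp (p + d) \<in> pair_span A D"
  using pair_span.step[OF pair_span.zero] by simp

lemma pair_span_add:
  assumes "F \<in> pair_span A D" "G \<in> pair_span A D"
  shows "F + G \<in> pair_span A D"
  using assms(2)
proof induction
  case zero
  then show ?case using assms(1) by simp
next
  case (step G p d)
  then show ?case using pair_span.step[of "F + G"] by (simp add: add.assoc)
qed

lemma pair_span_add_cancel:
  assumes "F \<in> pair_span A D"
  shows "F + G \<in> pair_span A D \<longleftrightarrow> G \<in> pair_span A D"
  using pair_span_add[OF assms] by (metis lamps_add_self_left)

lemma pair_span_mono:
  assumes "A \<subseteq> A'" "D \<subseteq> D'"
  shows "pair_span A D \<subseteq> pair_span A' D'"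
proof
  fix F assume "F \<in> pair_span A D"
  then show "F \<in> pair_span A' D'"
    using assms by induction (auto intro: pair_span.intros)
qed

lemma shift_pair_span: "F \<in> pair_span UNIV D \<Longrightarrow> shift e F \<in> pair_span UNIV D"
proof (induction rule: pair_span.induct)
  case (step F p d)
  then show ?case
    using pair_span.step[of "shift e F" UNIV D "p + e" d] by (simp add: shift_add algebra_simps)
qed (simp add: pair_span.zero)

text \<open>The ideal generated by a union is the sum of the two ideals.\<close>

lemma pair_span_Un:
  assumes "F \<in> pair_span A (D \<union> E)"
  shows "\<exists>G\<in>pair_span A D. \<exists>H\<in>pair_span A E. F = G + H"
  using assms
proof induction
  case zero
  show ?case using pair_span.zero by (metis add_0)
next
  case (step F p d)
  then obtain G H where GH: "G \<in> pair_span A D" "H \<in> pair_span A E" "F = G + H" by blast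
  let ?P = "lamp p + lamp (p + d)"
  from step(3) show ?case
  proof
    assume "d \<in> D"
    then have "G + ?P \<in> pair_span A D" using GH step by (intro pair_span.step)
    moreover have "F + ?P = (G + ?P) + H" by (simp add: GH add_ac)
    ultimately show ?thesis using GH by blast
  next
    assume "d \<in> E"
    then have "H + ?P \<in> pair_span A E" using GH step by (intro pair_span.step)
    moreover have "F + ?P = G + (H + ?P)" by (simp add: GH add_ac)
    ultimately show ?thesis using GH by blast
  qed
qed

text \<open>Here \<open>h\<close> is the cofactor of 1 + T^d, and each of its lamps contributes one
  generator placed at that lamp. So the support of the cofactor controls the positions used.\<close>

lemma in_pair_span_single:
  assumes "finite (lit h)" "lit h \<subseteq> A"
  shows "h + shift d h \<in> pair_span A {d}"
  using assms
proof (induction h rule: finite_lit_induct)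
  case zero
  show ?case by (simp add: pair_span.zero)
next
  case (toggle F p)
  have "lit (F + lamp p) = insert p (lit F)"
    using toggle.hyps by (intro lit_toggle_on)
  then have "F + shift d F \<in> pair_span A {d}" "p \<in> A"
    using toggle by auto
  from pair_span.step[OF this, of d] show ?case
    by (simp add: shift_add add_ac)
qed

lemma pair_span_singleE:
  assumes "F \<in> pair_span A {d}"
  obtains h where "finite (lit h)" "F = h + shift d h"
proof -
  from assms have "\<exists>h. finite (lit h) \<and> F = h + shift d h"
  proof induction
    case zero
    show ?case by (intro exI[of _ 0]) simp
  next
    case (step F p e)
    then obtain h where "finite (lit h)" "F = h + shift d h" by blast
    then show ?case using step
      by (intro exI[of _ "h + lamp p"]) (simp add: finite_lit_add shift_add add_ac)
  qed
  then show thesis using that by blast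
qed

text \<open>1 + T^(-d) and 1 + T^d differ by the unit T^(-d): the pair at \<open>p\<close> with
  distance \<open>d\<close> is the pair at \<open>p + d\<close> with distance
  \<open>- d\<close>.\<close>

lemma pair_span_UNIV_uminus:
  assumes "F \<in> pair_span UNIV D" "\<And>d. d \<in> D \<Longrightarrow> d \<in> E \<or> - d \<in> E"
  shows "F \<in> pair_span UNIV E"
  using assms(1)
proof induction
  case zero
  show ?case by (rule pair_span.zero)
next
  case (step F p d)
  from assms(2)[OF step(3)] show ?case
  proof
    assume "- d \<in> E"
    from pair_span.step[OF step(4) _ this, of "p + d"] show ?thesis
      by (simp add: add_ac)
  qed (use step in \<open>auto intro: pair_span.step\<close>)
qed

section \<open>The equation in terms of lamps\<close>

fun letter_shift :: "letter \<Rightarrow> int" where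
  "letter_shift Pos_t = 1"
| "letter_shift Neg_t = - 1"
| "letter_shift _ = 0"

definition word_shift :: "letter list \<Rightarrow> int" where
  "word_shift w = sum_list (map letter_shift w)"

text \<open>The product moves the lamps of its left factor by minus the shift of its right factor,
  so a letter \<open>a\<close> acts at minus the shift of the suffix after it. Lamps have order two,
  so \<open>a\<close> and its inverse act alike.\<close>

fun word_lamps :: "letter list \<Rightarrow> lamps" where
  "word_lamps [] = 0"
| "word_lamps (l # v) =
    (if l = Pos_a \<or> l = Neg_a then word_lamps v + lamp (- word_shift v) else word_lamps v)"

definition total_shift :: "letter list list \<Rightarrow> int" where
  "total_shift cs = sum_list (map word_shift cs)"

definition placed :: "int list \<Rightarrow> letter list list \<Rightarrow> lamps" where
  "placed es cs = sum_list (map2 (\<lambda>e c. shift e (word_lamps c)) es cs)"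

lemma word_shift_simps [simp]:
  "word_shift [] = 0" "word_shift (l # v) = letter_shift l + word_shift v"
  by (simp_all add: word_shift_def)

lemma total_shift_simps [simp]:
  "total_shift [] = 0" "total_shift (c # cs) = word_shift c + total_shift cs"
  by (simp_all add: total_shift_def)

lemma placed_simps [simp]:
  "placed [] [] = 0" "placed (e # es) (c # cs) = shift e (word_lamps c) + placed es cs"
  by (simp_all add: placed_def)

lemma finite_lit_word_lamps [simp]: "finite (lit (word_lamps w))"
  by (induction w) (simp_all add: finite_lit_add)

section \<open>Group operations in terms of shifts and lamps\<close>

interpretation lamplighter: group lamplighter
  by (rule group_lamplighter)

lemma carrier_lamplighter_iff [simp]: "(d, f) \<in> carrier lamplighter \<longleftrightarrow> finite (lit f)"
  by (simp add: lamplighter_def lit_def)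

lemma one_lamplighter: "\<one>\<^bsub>lamplighter\<^esub> = (0, 0)"
  by (simp add: lamplighter_def zero_fun_def)

lemma mult_lamplighter [simp]:
  "(d1, f1) \<otimes>\<^bsub>lamplighter\<^esub> (d2, f2) = (d1 + d2, shift (- d2) f1 + f2)"
  by (simp add: lamplighter_def shift_def plus_fun_def)

lemma inv_lamplighter [simp]:
  assumes "finite (lit f)"
  shows "inv\<^bsub>lamplighter\<^esub> (d, f) = (- d, shift d f)"
  using assms by (intro lamplighter.inv_equality) (simp_all add: one_lamplighter finite_lit_shift)

lemma letter_value_eq:
  "letter_value l = (letter_shift l, if l = Pos_a \<or> l = Neg_a then lamp 0 else 0)"
proof -
  have a: "lamp_a = (0, lamp 0)" and t: "lamp_t = (1, 0)"
    by (simp_all add: lamp_a_def lamp_def lamp_t_def zero_fun_def)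
  show ?thesis by (cases l) (simp_all add: a t)
qed

lemma word_value_eq: "word_value w = (word_shift w, word_lamps w)"
  by (induction w)
     (auto simp: word_value_def list_product_def one_lamplighter letter_value_eq add.commute)

lemma list_product_simps:
  "list_product G [] = \<one>\<^bsub>G\<^esub>" "list_product G (g # gs) = g \<otimes>\<^bsub>G\<^esub> list_product G gs"
  by (simp_all add: list_product_def)

text \<open>The coordinates of the conjugator act separately: its shift translates \<open>f\<close>
  freely, and its lamps add a multiple of 1 + T^(-d). Placements and distances both arise from this
  formula.\<close>

lemma conjugate_lamplighter:
  assumes "finite (lit f)" "finite (lit h)"
  shows "inv\<^bsub>lamplighter\<^esub> (e, h) \<otimes>\<^bsub>lamplighter\<^esub> (d, f) \<otimes>\<^bsub>lamplighter\<^esub> (e, h)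
    = (d, shift (- e) f + (h + shift (- d) h))"
  using assms by (simp add: shift_add add_ac)

abbreviation (input) conjugates :: "(int \<times> lamps) list \<Rightarrow> letter list list \<Rightarrow> (int \<times> lamps) list" where
  "conjugates zs cs \<equiv>
    map2 (\<lambda>z c. inv\<^bsub>lamplighter\<^esub> z \<otimes>\<^bsub>lamplighter\<^esub> word_value c \<otimes>\<^bsub>lamplighter\<^esub> z) zs cs"

text \<open>Each conjugate contributes a translate of its word's lamps and an element of the ideal;
  the factors to its right only translate both further, which the ideal tolerates.\<close>

lemma product_conjugates_imp_placed:
  assumes "length zs = length cs" "set zs \<subseteq> carrier lamplighter"
  shows "\<exists>es U. length es = length cs
    \<and> list_product lamplighter (conjugates zs cs) = (total_shift cs, U)
    \<and> U + placed es cs \<in> pair_span UNIV (word_shift ` set cs)"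
  using assms
proof (induction zs cs rule: list_induct2)
  case Nil
  show ?case by (simp add: list_product_def one_lamplighter pair_span.zero)
next
  case (Cons z zs c cs)
  obtain e h where z: "z = (e, h)" by (cases z)
  with Cons have fin: "finite (lit h)" by simp
  from Cons obtain es U where IH: "length es = length cs"
      "list_product lamplighter (conjugates zs cs) = (total_shift cs, U)"
      "U + placed es cs \<in> pair_span UNIV (word_shift ` set cs)"
    by auto
  let ?D = "total_shift cs" and ?d = "word_shift c"
  let ?u = "h + shift (- ?d) h"
  let ?U = "shift (- ?D) (shift (- e) (word_lamps c) + ?u) + U"
  have "list_product lamplighter (conjugates (z # zs) (c # cs)) = (total_shift (c # cs), ?U)"
    using IH(2) conjugate_lamplighter[OF finite_lit_word_lamps fin]
    by (simp only: zip_Cons_Cons list.map prod.case list_product_simps z word_value_eq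
          mult_lamplighter total_shift_simps)
  moreover have "?u \<in> pair_span UNIV {- ?d}"
    using fin by (intro in_pair_span_single) simp_all
  then have "?u \<in> pair_span UNIV (word_shift ` set (c # cs))"
    by (rule pair_span_UNIV_uminus) auto
  moreover have "pair_span UNIV (word_shift ` set cs) \<subseteq> pair_span UNIV (word_shift ` set (c # cs))"
    by (intro pair_span_mono) auto
  ultimately have "shift (- ?D) ?u + (U + placed es cs) \<in> pair_span UNIV (word_shift ` set (c # cs))"
    using IH(3) by (blast intro: pair_span_add shift_pair_span)
  \<comment> \<open>The exponent \<open>- e - ?D\<close> combines the translation by the conjugator
    with that by the remaining product, so the two copies of the lamps of \<open>c\<close>
    cancel.\<close>
  also have "shift (- ?D) ?u + (U + placed es cs) = ?U + placed ((- e - ?D) # es) (c # cs)"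
    by (simp add: shift_add add_ac)
  finally show ?case
    using IH(1) \<open>list_product lamplighter (conjugates (z # zs) (c # cs)) = _\<close>
    by (intro exI[of _ "(- e - ?D) # es"] exI[of _ ?U]) simp
qed

text \<open>The part of the ideal element that belongs to the first word becomes the lamps of the
  first conjugator; the remaining words have to produce what is left of \<open>U\<close>.\<close>

lemma placed_imp_product_conjugates:
  assumes "length es = length cs" "U + placed es cs \<in> pair_span UNIV (word_shift ` set cs)"
  shows "\<exists>zs. length zs = length cs \<and> set zs \<subseteq> carrier lamplighter
    \<and> list_product lamplighter (conjugates zs cs) = (total_shift cs, U)"
  using assms
proof (induction es cs arbitrary: U rule: list_induct2)
  case Nil
  have "U = 0"
    using Nil(1) by (auto elim: pair_span.cases)
  then show ?case by (simp add: list_product_def one_lamplighter)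
next
  case (Cons e es c cs)
  let ?D = "total_shift cs" and ?d = "word_shift c"
  have "U + placed (e # es) (c # cs) \<in> pair_span UNIV (word_shift ` set cs \<union> {?d})"
    using Cons.prems by (simp add: insert_is_Un[symmetric])
  then obtain G H where GH: "G \<in> pair_span UNIV (word_shift ` set cs)" "H \<in> pair_span UNIV {?d}"
      "U + placed (e # es) (c # cs) = G + H"
    by (blast dest: pair_span_Un)
  \<comment> \<open>The product will move the lamps of the first factor by \<open>- ?D\<close>; this
    is compensated in advance.\<close>
  have "shift ?D H \<in> pair_span UNIV {- ?d}"
    by (rule pair_span_UNIV_uminus[OF shift_pair_span[OF GH(2)]]) simp
  then obtain h where h: "finite (lit h)" "shift ?D H = h + shift (- ?d) h"
    by (rule pair_span_singleE)
  have "(U + shift e (word_lamps c) + H) + placed es cs = (U + placed (e # es) (c # cs)) + H"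
    by (simp add: add_ac)
  also have "\<dots> = G"
    unfolding GH(3) by (simp add: add.assoc)
  finally have "(U + shift e (word_lamps c) + H) + placed es cs \<in> pair_span UNIV (word_shift ` set cs)"
    using GH(1) by (simp only:)
  from Cons.IH[OF this] obtain zs where zs: "length zs = length cs" "set zs \<subseteq> carrier lamplighter"
      "list_product lamplighter (conjugates zs cs) = (?D, U + shift e (word_lamps c) + H)"
    by blast
  \<comment> \<open>The shift of the conjugator solves \<open>- e' - ?D = e\<close> for
    \<open>e'\<close>.\<close>
  let ?z = "(- ?D - e, h)"
  let ?P = "shift e (word_lamps c)"
  have "shift (- ?D) (shift (- (- ?D - e)) (word_lamps c) + shift ?D H) = ?P + H"
    by (simp add: shift_add)
  then have "shift (- ?D) (shift (- (- ?D - e)) (word_lamps c) + shift ?D H) + (U + ?P + H)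
      = (?P + H) + ((?P + H) + U)"
    by (simp only: add_ac)
  then have "shift (- ?D) (shift (- (- ?D - e)) (word_lamps c) + shift ?D H) + (U + ?P + H) = U"
    by (simp only: lamps_add_self_left)
  then have "list_product lamplighter (conjugates (?z # zs) (c # cs)) = (total_shift (c # cs), U)"
    using zs(3) conjugate_lamplighter[OF finite_lit_word_lamps h(1)] h(2)
    by (simp only: zip_Cons_Cons list.map prod.case list_product_simps word_value_eq
          mult_lamplighter total_shift_simps)
  then show ?case
    using zs h(1) by (intro exI[of _ "?z # zs"]) simp
qed

section \<open>The solvability criterion\<close>

definition solvable :: "letter list list \<Rightarrow> bool" where
  "solvable cs \<longleftrightarrow>
    (\<exists>x \<in> carrier lamplighter. \<exists>zs.
      length zs = length cs \<and> set zs \<subseteq> carrier lamplighter \<and>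
      x [^]\<^bsub>lamplighter\<^esub> (2::nat) \<otimes>\<^bsub>lamplighter\<^esub>
        list_product lamplighter (conjugates zs cs) = \<one>\<^bsub>lamplighter\<^esub>)"

text \<open>For x = (d, g) the lamps of the square are a multiple of 1 + T^(-d), and comparing
  shifts forces d to be minus half the total shift. This explains the extra distance.\<close>

definition distances :: "letter list list \<Rightarrow> int set" where
  "distances cs = insert (total_shift cs div 2) (word_shift ` set cs)"

lemma square_lamplighter:
  assumes "finite (lit g)"
  shows "(d, g) [^]\<^bsub>lamplighter\<^esub> (2::nat) = (2 * d, g + shift (- d) g)"
  using assms by (simp add: numeral_2_eq_2 one_lamplighter add.commute)

theorem solvable_iff:
  "solvable cs \<longleftrightarrow> even (total_shift cs) \<and>
    (\<exists>es. length es = length cs \<and> placed es cs \<in> pair_span UNIV (distances cs))"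
  (is "_ \<longleftrightarrow> ?R")
proof
  assume "solvable cs"
  then obtain d g zs where g: "finite (lit g)" and zs: "length zs = length cs"
      "set zs \<subseteq> carrier lamplighter" and
      eq: "(d, g) [^]\<^bsub>lamplighter\<^esub> (2::nat) \<otimes>\<^bsub>lamplighter\<^esub>
        list_product lamplighter (conjugates zs cs) = \<one>\<^bsub>lamplighter\<^esub>"
    by (auto simp: solvable_def)
  from product_conjugates_imp_placed[OF zs] obtain es U where es: "length es = length cs"
      "list_product lamplighter (conjugates zs cs) = (total_shift cs, U)"
      "U + placed es cs \<in> pair_span UNIV (word_shift ` set cs)"
    by blast
  let ?D = "total_shift cs"
  from eq have D: "2 * d + ?D = 0" and U: "shift (- ?D) (g + shift (- d) g) = U"
    unfolding es(2) square_lamplighter[OF g] by (simp_all add: one_lamplighter lamps_add_eq_0_iff)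
  have "?D = 2 * (- d)" using D by linarith
  then have d: "even ?D" "?D div 2 = - d" by simp_all
  have "shift (- ?D) (g + shift (- d) g) \<in> pair_span UNIV {- d}"
    using g by (intro shift_pair_span in_pair_span_single) simp_all
  then have "U \<in> pair_span UNIV (distances cs)"
    unfolding U using pair_span_mono[of UNIV UNIV "{- d}" "distances cs"] by (auto simp: distances_def d)
  moreover have "U + placed es cs \<in> pair_span UNIV (distances cs)"
    using es(3) pair_span_mono[of UNIV UNIV "word_shift ` set cs" "distances cs"]
    by (auto simp: distances_def)
  ultimately show ?R
    using es(1) d(1) pair_span_add_cancel by blast
next
  assume ?R
  then obtain d es where D: "total_shift cs = 2 * d" and es: "length es = length cs"
      "placed es cs \<in> pair_span UNIV (word_shift ` set cs \<union> {d})"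
    by (auto simp: distances_def elim!: evenE)
  then obtain G H where GH: "G \<in> pair_span UNIV (word_shift ` set cs)" "H \<in> pair_span UNIV {d}"
      "placed es cs = G + H"
    by (blast dest: pair_span_Un)
  have "H + placed es cs = G"
    by (simp add: GH(3) add_ac)
  then obtain zs where zs: "length zs = length cs" "set zs \<subseteq> carrier lamplighter"
      "list_product lamplighter (conjugates zs cs) = (total_shift cs, H)"
    using placed_imp_product_conjugates[OF es(1), of H] GH(1) by auto
  \<comment> \<open>The square stands to the left of a product with shift \<open>2 * d\<close>,
    which moves its lamps by \<open>- (2 * d)\<close>.\<close>
  from shift_pair_span[OF GH(2), of "2 * d"]
  obtain g where g: "finite (lit g)" "shift (2 * d) H = g + shift d g"
    by (rule pair_span_singleE)
  have "H = shift (- (2 * d)) (g + shift d g)"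
    using arg_cong[OF g(2), of "shift (- (2 * d))"] by simp
  then have "(- d, g) [^]\<^bsub>lamplighter\<^esub> (2::nat) \<otimes>\<^bsub>lamplighter\<^esub>
      list_product lamplighter (conjugates zs cs) = \<one>\<^bsub>lamplighter\<^esub>"
    unfolding zs(3) square_lamplighter[OF g(1)] by (simp add: one_lamplighter D)
  then show "solvable cs"
    unfolding solvable_def using zs g(1) by (intro bexI[of _ "(- d, g)"]) auto
qed

section \<open>Solutions of polynomial size\<close>

lemma abs_word_shift_le: "\<bar>word_shift w\<bar> \<le> int (length w)"
proof (induction w)
  case (Cons l v)
  have "\<bar>letter_shift l\<bar> \<le> 1" by (cases l) simp_all
  then show ?case using Cons by simp
qed simp

lemma lit_word_lamps: "lit (word_lamps w) \<subseteq> {- int (length w)..int (length w)}"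
proof (induction w)
  case (Cons l v)
  have "lit (word_lamps (l # v)) \<subseteq> lit (word_lamps v) \<union> {- word_shift v}"
    using lit_add_subset[of "word_lamps v" "lamp (- word_shift v)"] by auto
  also have "\<dots> \<subseteq> {- int (length (l # v))..int (length (l # v))}"
    using Cons abs_word_shift_le[of v] by auto
  finally show ?case .
qed simp

lemma pair_span_zero_distance: "pair_span A {0} = {0}"
proof
  show "pair_span A {0} \<subseteq> {0}"
  proof
    fix F assume "F \<in> pair_span A {0}"
    then show "F \<in> {0}" by induction simp_all
  qed
qed (simp add: pair_span.zero)

lemma lit_pair_span:
  assumes "F \<in> pair_span A D"
  shows "lit F \<subseteq> A \<union> {p + d | p d. p \<in> A \<and> d \<in> D}"
  using assms
proof induction
  case (step F p d)
  have "lit (F + (lamp p + lamp (p + d))) \<subseteq> lit F \<union> ({p} \<union> {p + d})"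
    using lit_add_subset[of F "lamp p + lamp (p + d)"] lit_add_subset[of "lamp p" "lamp (p + d)"]
    by auto
  then show ?case using step by blast
qed simp

text \<open>A generator used twice cancels, so a set of generators suffices. This bounds the number
  of pairs that the verifier has to toggle.\<close>

lemma pair_span_eq_sum:
  assumes "F \<in> pair_span A D"
  obtains Q where "finite Q" "Q \<subseteq> A \<times> D" "F = (\<Sum>(p, d)\<in>Q. lamp p + lamp (p + d))"
proof -
  let ?S = "\<lambda>Q. \<Sum>(p, d)\<in>Q. lamp p + lamp (p + d)"
  from assms have "\<exists>Q. finite Q \<and> Q \<subseteq> A \<times> D \<and> F = ?S Q"
  proof induction
    case zero
    show ?case by (intro exI[of _ "{}"]) simp
  next
    case (step F p d)
    then obtain Q where Q: "finite Q" "Q \<subseteq> A \<times> D" "F = ?S Q" by blast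
    show ?case
    proof (cases "(p, d) \<in> Q")
      case True
      have "?S Q = (lamp p + lamp (p + d)) + ?S (Q - {(p, d)})"
        using Q(1) True by (simp add: sum.remove)
      then have "F + (lamp p + lamp (p + d)) = ?S (Q - {(p, d)})"
        unfolding Q(3) by (simp only: add.commute[of _ "lamp p + lamp (p + d)"] lamps_add_self_left)
      then show ?thesis
        using Q by (intro exI[of _ "Q - {(p, d)}"]) auto
    next
      case False
      then have "F + (lamp p + lamp (p + d)) = ?S (insert (p, d) Q)"
        using Q by (simp add: add_ac)
      then show ?thesis
        using Q step by (intro exI[of _ "insert (p, d) Q"]) auto
    qed
  qed
  then show thesis using that by blast
qed

section \<open>Reduction of positions modulo a distance\<close>

lemma lamp_pair_multiple:
  assumes "d dvd q - p"
  shows "lamp p + lamp q \<in> pair_span UNIV {d}"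
proof -
  \<comment> \<open>Telescoping: 1 + T^(kd) is a sum of \<open>k\<close> consecutive pairs at
    distance \<open>d\<close>.\<close>
  have *: "lamp p + lamp (p + int k * d) \<in> pair_span UNIV {d}" for p k
  proof (induction k)
    case 0
    show ?case by (simp add: pair_span.zero)
  next
    case (Suc k)
    from pair_span.step[OF Suc UNIV_I, of d "p + int k * d"]
    show ?case by (simp add: add.assoc algebra_simps)
  qed
  from assms obtain j where j: "q = p + d * j"
    by (metis dvdE diff_add_cancel add.commute)
  show ?thesis
  proof (cases "j \<ge> 0")
    case True
    then show ?thesis using *[of p "nat j"] by (simp add: j mult.commute)
  next
    case False
    then show ?thesis using *[of q "nat (- j)"] by (simp add: j mult.commute add.commute)
  qed
qed

lemma shift_pair_multiple:
  assumes "finite (lit F)" "d dvd e' - e"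
  shows "shift e F + shift e' F \<in> pair_span UNIV {d}"
  using assms(1)
proof (induction F rule: finite_lit_induct)
  case zero
  show ?case by (simp add: pair_span.zero)
next
  case (toggle F p)
  have "lamp (p + e) + lamp (p + e') \<in> pair_span UNIV {d}"
    using assms(2) by (intro lamp_pair_multiple) simp
  from pair_span_add[OF toggle.IH this] show ?case
    by (simp add: shift_add add_ac)
qed

lemma placed_mod:
  assumes "length es = length cs"
  shows "placed es cs + placed (map (\<lambda>e. e mod d) es) cs \<in> pair_span UNIV {d}"
  using assms
proof (induction es cs rule: list_induct2)
  case Nil
  show ?case by (simp add: pair_span.zero)
next
  case (Cons e es c cs)
  have "shift e (word_lamps c) + shift (e mod d) (word_lamps c) \<in> pair_span UNIV {d}"
    by (intro shift_pair_multiple) (simp_all add: mod_eq_dvd_iff[symmetric])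
  from pair_span_add[OF this Cons.IH] show ?case
    by (simp add: add_ac)
qed

text \<open>Each generator is moved to the residue of its position. Both of its lamps then move by
  the same multiple of \<open>d\<close>, so the error is a multiple of 1 + T^d.\<close>

lemma pair_span_mod:
  assumes "F \<in> pair_span UNIV D" "\<And>p. p mod d \<in> A"
  shows "\<exists>F'\<in>pair_span A D. F + F' \<in> pair_span UNIV {d}"
  using assms(1)
proof induction
  case zero
  show ?case by (intro bexI[of _ 0]) (simp_all add: pair_span.zero)
next
  case (step F p e)
  then obtain F' where F': "F' \<in> pair_span A D" "F + F' \<in> pair_span UNIV {d}" by blast
  let ?q = "p mod d"
  have "lamp p + lamp ?q \<in> pair_span UNIV {d}" "lamp (p + e) + lamp (?q + e) \<in> pair_span UNIV {d}"
    by (intro lamp_pair_multiple; simp add: mod_eq_dvd_iff[symmetric])+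
  from pair_span_add[OF F'(2) pair_span_add[OF this]]
  have "(F + (lamp p + lamp (p + e))) + (F' + (lamp ?q + lamp (?q + e))) \<in> pair_span UNIV {d}"
    by (simp add: add_ac)
  moreover have "F' + (lamp ?q + lamp (?q + e)) \<in> pair_span A D"
    using F' step assms(2) by (intro pair_span.step)
  ultimately show ?case by blast
qed

text \<open>If some element were below \<open>b\<close>, so would be the minimum, and subtracting
  \<open>s\<close> would give a smaller element.\<close>

lemma finite_downward_bound:
  fixes S :: "int set"
  assumes "finite S" "s > 0" "\<And>y. y \<in> S \<Longrightarrow> y < b \<Longrightarrow> y - s \<in> S" "x \<in> S"
  shows "b \<le> x"
proof (rule ccontr)
  assume "\<not> b \<le> x"
  moreover have "Min S \<in> S" "Min S \<le> x"
    using Min_in[of S] Min_le[of S x] assms(1,4) by blast+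
  ultimately have "Min S - s \<in> S"
    using assms(3) by simp
  then show False
    using Min_le[OF assms(1)] assms(2) by fastforce
qed

text \<open>
  A finitely supported multiple \<open>(1 + T\<^sup>d) h\<close> that vanishes far out forces \<open>h\<close> to be
  periodic, hence zero, there.
\<close>

lemma pair_span_single_bounded:
  assumes "G \<in> pair_span UNIV {d}" "d \<noteq> 0" "lit G \<subseteq> {- B..B}"
  shows "G \<in> pair_span {- B..B} {d}"
proof -
  obtain h where h: "finite (lit h)" "G = h + shift d h"
    using assms(1) by (rule pair_span_singleE)
  let ?s = "\<bar>d\<bar>"
  have per: "h y = h (y - d)" if "y \<notin> {- B..B}" for y
  proof -
    have "G y = 0"
      using that assms(3) not_in_lit_iff by blast
    then have "h y + h (y - d) = 0"
      by (simp add: h(2) plus_fun_apply shift_def)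
    then show ?thesis
      by (cases "h y"; cases "h (y - d)") simp_all
  qed
  \<comment> \<open>The sign of \<open>d\<close> decides whether the relation is applied at
    \<open>y\<close> or at \<open>y + d\<close>; in each case the point used lies beyond the
    bound.\<close>
  have down: "h (y - ?s) = h y" if "y < - B" for y
    using per[of y] per[of "y + d"] that by (cases "d > 0") auto
  have up: "h (y + ?s) = h y" if "y > B" for y
    using per[of y] per[of "y + d"] that by (cases "d > 0") auto
  have "- B \<le> x \<and> x \<le> B" if x: "x \<in> lit h" for x
  proof
    show "- B \<le> x"
      using h(1) assms(2) down x
      by (intro finite_downward_bound[of "lit h" ?s]) (auto simp: in_lit_iff)
    have "- B \<le> - x"
      using h(1) assms(2) up x
    proof (intro finite_downward_bound[of "uminus ` lit h" ?s])
      fix y assume "y \<in> uminus ` lit h" "y < - B"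
      then have "- y + ?s \<in> lit h"
        using up[of "- y"] by (auto simp: in_lit_iff)
      then show "y - ?s \<in> uminus ` lit h"
        by (intro image_eqI[of _ _ "- y + ?s"]) auto
    qed auto
    then show "x \<le> B" by simp
  qed
  then show ?thesis
    unfolding h(2) using h(1) by (intro in_pair_span_single) auto
qed

section \<open>Zero sums of translated patterns\<close>

lemma lit_sum_subset:
  assumes "\<And>i. i \<in> I \<Longrightarrow> lit (F i) \<subseteq> S"
  shows "lit (\<Sum>i\<in>I. F i) \<subseteq> S"
  using assms
proof (induction I rule: infinite_finite_induct)
  case (insert i I)
  then show ?case
    using lit_add_subset[of "F i" "\<Sum>i\<in>I. F i"] by simp blast
qed simp_all

lemma lamps_sum_disjoint:
  assumes "F + G = 0" "lit F \<subseteq> S" "lit G \<subseteq> - S"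
  shows "F = (0 :: lamps)" "G = 0"
proof -
  have "F = G" using assms(1) by (simp add: lamps_add_eq_0_iff)
  then have "lit F = {}" "lit G = {}" using assms(2,3) by blast+
  then show "F = 0" "G = 0" by (simp_all add: lit_eq_empty_iff)
qed

text \<open>
  If the positions leave a gap of length \<open>2n + 1\<close>, the patterns below and above the gap cancel
  separately. Otherwise the pigeonhole principle bounds the spread of the positions.
\<close>

lemma squeeze_positions:
  fixes F :: "'i \<Rightarrow> lamps" and n :: int
  assumes "finite I" "n \<ge> 0" "\<And>i. i \<in> I \<Longrightarrow> lit (F i) \<subseteq> {- n..n}"
    and "(\<Sum>i\<in>I. shift (e i) (F i)) = 0"
  shows "\<exists>e'. (\<forall>i\<in>I. 0 \<le> e' i \<and> e' i \<le> int (card I) * (2 * n + 1)) \<and>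
    (\<Sum>i\<in>I. shift (e' i) (F i)) = 0"
  using assms(1,3,4)
proof (induction I rule: finite_psubset_induct)
  case (psubset I)
  let ?M = "2 * n + 1" and ?k = "card I"
  show ?case
  proof (cases "I = {}")
    case True
    then show ?thesis by simp
  next
    case False
    define m where "m = Min (e ` I)"
    have "m \<in> e ` I"
      unfolding m_def using psubset.hyps(1) False by (intro Min_in) auto
    then obtain i0 where i0: "i0 \<in> I" "e i0 = m" by auto
    have m_le: "m \<le> e i" if "i \<in> I" for i
      using that psubset.hyps(1) by (simp add: m_def)
    show ?thesis
    \<comment> \<open>Here \<open>g\<close> starts a window of \<open>2 * n + 1\<close> free
      positions above the least one, with further positions beyond it.\<close>
    proof (cases "\<exists>g\<ge>m + 1. (\<forall>i\<in>I. e i \<notin> {g..<g + ?M}) \<and> (\<exists>i\<in>I. g \<le> e i)")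
      case True
      then obtain g i1 where g: "g \<ge> m + 1" "\<And>i. i \<in> I \<Longrightarrow> e i \<notin> {g..<g + ?M}"
        and i1: "i1 \<in> I" "g \<le> e i1" by blast
      define L where "L = {i \<in> I. e i < g}"
      define H where "H = {i \<in> I. g \<le> e i}"
      have LH: "I = L \<union> H" "L \<inter> H = {}" "finite L" "finite H"
        using psubset.hyps(1) by (auto simp: L_def H_def)
      have "L \<subseteq> I" "H \<subseteq> I" "i1 \<notin> L" "i0 \<notin> H"
        using i0 i1 g(1) by (auto simp: L_def H_def)
      with i0(1) i1(1) have sub: "L \<subset> I" "H \<subset> I" by blast+
      let ?S = "\<lambda>I. \<Sum>i\<in>I. shift (e i) (F i)"
      have sum: "?S L + ?S H = 0"
        using psubset.prems(2) LH by (simp add: sum.union_disjoint)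
      \<comment> \<open>Patterns placed below the window end before \<open>g + n\<close>, those
        placed beyond it begin after \<open>g + n\<close>, so this cut separates the
        supports.\<close>
      have "lit (shift (e i) (F i)) \<subseteq> {..< g + n}" if "i \<in> L" for i
        using that psubset.prems(1)[of i] by (auto simp: L_def lit_shift)
      then have litL: "lit (?S L) \<subseteq> {..< g + n}" by (rule lit_sum_subset)
      have "lit (shift (e i) (F i)) \<subseteq> - {..< g + n}" if "i \<in> H" for i
        using that psubset.prems(1)[of i] g(2)[of i] by (force simp: H_def lit_shift)
      then have litH: "lit (?S H) \<subseteq> - {..< g + n}" by (rule lit_sum_subset)
      note zero = lamps_sum_disjoint[OF sum litL litH]
      \<comment> \<open>Each part sums to zero on its own, so the parts may be placed independently
        and may even overlap.\<close>
      obtain eL where eL: "\<forall>i\<in>L. 0 \<le> eL i \<and> eL i \<le> int (card L) * ?M"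
          "(\<Sum>i\<in>L. shift (eL i) (F i)) = 0"
        using psubset.IH[OF sub(1)] psubset.prems(1) zero(1) sub(1) by blast
      obtain eH where eH: "\<forall>i\<in>H. 0 \<le> eH i \<and> eH i \<le> int (card H) * ?M"
          "(\<Sum>i\<in>H. shift (eH i) (F i)) = 0"
        using psubset.IH[OF sub(2)] psubset.prems(1) zero(2) sub(2) by blast
      define e' where "e' i = (if i \<in> L then eL i else eH i)" for i
      have "int (card L) * ?M \<le> int ?k * ?M" "int (card H) * ?M \<le> int ?k * ?M"
        using LH psubset.hyps(1) assms(2) by (auto intro!: mult_right_mono card_mono)
      then have "\<forall>i\<in>I. 0 \<le> e' i \<and> e' i \<le> int ?k * ?M"
        using eL(1) eH(1) LH(1) unfolding e'_def by fastforce
      moreover have "(\<Sum>i\<in>L. shift (e' i) (F i)) = 0"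
        using eL(2) by (simp add: e'_def)
      moreover have "(\<Sum>i\<in>H. shift (e' i) (F i)) = (\<Sum>i\<in>H. shift (eH i) (F i))"
        using LH(2) by (intro sum.cong) (auto simp: e'_def)
      ultimately show ?thesis
        using LH eH(2) by (intro exI[of _ e']) (simp add: sum.union_disjoint)
    next
      case False
      \<comment> \<open>Otherwise each of \<open>?k\<close> disjoint windows above \<open>m\<close>
        would contain a position, but only \<open>?k - 1\<close> indices other than
        \<open>i0\<close> are available.\<close>
      have "e i \<le> m + int ?k * ?M" if i: "i \<in> I" for i
      proof (rule ccontr)
        assume *: "\<not> e i \<le> m + int ?k * ?M"
        have "\<exists>i'\<in>I. e i' \<in> {m + 1 + int j * ?M..<m + 1 + int j * ?M + ?M}" if "j < ?k" for j
        proof -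
          have "int j * ?M \<le> int ?k * ?M"
            using that assms(2) by (intro mult_right_mono) auto
          then have "m + 1 + int j * ?M \<le> e i"
            using * by linarith
          moreover have "m + 1 + int j * ?M \<ge> m + 1"
            using assms(2) by simp
          ultimately show ?thesis
            using False i by blast
        qed
        then obtain f where f: "\<And>j. j < ?k \<Longrightarrow> f j \<in> I"
            "\<And>j. j < ?k \<Longrightarrow> e (f j) \<in> {m + 1 + int j * ?M..<m + 1 + int j * ?M + ?M}"
          by metis
        have "inj_on f {..<?k}"
        proof (rule linorder_inj_onI)
          fix j j' assume j: "j < j'" "j \<in> {..<?k}" "j' \<in> {..<?k}"
          have "(int j + 1) * ?M \<le> int j' * ?M"
            using j assms(2) by (intro mult_right_mono) auto
          then have "int j * ?M + ?M \<le> int j' * ?M"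
            by (simp add: algebra_simps)
          then have "e (f j) < e (f j')"
            using f(2)[of j] f(2)[of j'] j by auto
          then show "f j \<noteq> f j'" by auto
        qed auto
        moreover have "f ` {..<?k} \<subseteq> I - {i0}"
        proof -
          have "m < e (f j)" if "j < ?k" for j
          proof -
            have "0 \<le> int j * ?M" using assms(2) by simp
            then show ?thesis
              using f(2)[OF that] unfolding atLeastLessThan_iff by linarith
          qed
          then show ?thesis using f(1) i0(2) by fastforce
        qed
        ultimately have "card {..<?k} \<le> card (I - {i0})"
          using psubset.hyps(1) by (intro card_inj_on_le[of f]) auto
        then show False
          using i0(1) psubset.hyps(1) card_gt_0_iff[of I] by auto
      qed
      moreover have "(\<Sum>i\<in>I. shift (e i - m) (F i)) = shift (- m) (\<Sum>i\<in>I. shift (e i) (F i))"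
        by (simp add: shift_sum)
      ultimately show ?thesis
        using m_le psubset.prems(2) by (intro exI[of _ "\<lambda>i. e i - m"]) force
    qed
  qed
qed

section \<open>Exponents of quadratic size\<close>

lemma placed_eq_sum:
  assumes "length es = length cs"
  shows "placed es cs = (\<Sum>i<length cs. shift (es ! i) (word_lamps (cs ! i)))"
  using assms by (simp add: placed_def sum_list_sum_nth atLeast0LessThan)

text \<open>If all distances vanish, the span is zero and \<open>squeeze_positions\<close> bounds
  the exponents of k words by k(2n + 1). Otherwise reduction modulo a nonzero distance bounds
  everything by 2n. \<open>N\<close> dominates both.\<close>

lemma bounded_solution:
  fixes n :: nat
  defines "N \<equiv> 2 * int n * (int n + 1)"
  assumes es: "length es = length cs" "placed es cs \<in> pair_span UNIV (distances cs)"
    and cs: "length cs \<le> n" "\<And>c. c \<in> set cs \<Longrightarrow> length c \<le> n" "\<bar>total_shift cs\<bar> \<le> n"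
  obtains es' where "length es' = length cs" "\<And>e. e \<in> set es' \<Longrightarrow> \<bar>e\<bar> \<le> N"
    "placed es' cs \<in> pair_span {- N..N} (distances cs)"
proof (cases "distances cs \<subseteq> {0}")
  case True
  have lits: "lit (word_lamps (cs ! i)) \<subseteq> {- int n..int n}" if "i < length cs" for i
    using lit_word_lamps[of "cs ! i"] cs(2)[of "cs ! i"] that by fastforce
  have "placed es cs \<in> pair_span UNIV {0}"
    using es(2) pair_span_mono[OF subset_refl True] by blast
  then have "(\<Sum>i<length cs. shift (es ! i) (word_lamps (cs ! i))) = 0"
    by (simp add: pair_span_zero_distance placed_eq_sum[OF es(1)])
  from squeeze_positions[OF finite_lessThan _ _ this, of "int n"] lits
  obtain e' where e': "\<forall>i<length cs. 0 \<le> e' i \<and> e' i \<le> int (length cs) * (2 * int n + 1)"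
      "(\<Sum>i<length cs. shift (e' i) (word_lamps (cs ! i))) = 0"
    by auto
  let ?es = "map e' [0..<length cs]"
  have "int (length cs) * (2 * int n + 1) \<le> int n * (2 * int n + 2)"
    using cs(1) by (intro mult_mono) auto
  then have N: "int (length cs) * (2 * int n + 1) \<le> N"
    by (simp add: N_def algebra_simps)
  show thesis
  proof (rule that[of ?es])
    show "\<bar>e\<bar> \<le> N" if "e \<in> set ?es" for e
      using that e'(1) N by fastforce
    have "placed ?es cs = 0"
      using e'(2) by (subst placed_eq_sum) simp_all
    then show "placed ?es cs \<in> pair_span {- N..N} (distances cs)"
      by (simp add: pair_span.zero)
  qed simp
next
  case False
  then obtain d where d: "d \<in> distances cs" "d \<noteq> 0" by blast
  have dist_le: "\<bar>d\<bar> \<le> n" if "d \<in> distances cs" for d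
  proof (cases "d = total_shift cs div 2")
    case True
    then show ?thesis using cs(3) by linarith
  next
    case False
    with that obtain c where "c \<in> set cs" "d = word_shift c" by (auto simp: distances_def)
    then show ?thesis using abs_word_shift_le[of c] cs(2)[of c] by linarith
  qed
  have mod: "\<bar>p mod d\<bar> \<le> n" for p
    using dist_le[OF d(1)] abs_mod_less[OF d(2), of p] by linarith
  let ?es = "map (\<lambda>e. e mod d) es"
  let ?A = "{- int n..int n}" and ?B = "{- (2 * int n)..2 * int n}"
  have "p mod d \<in> ?A" for p
    using mod[of p] by auto
  then obtain F where F: "F \<in> pair_span ?A (distances cs)" "placed es cs + F \<in> pair_span UNIV {d}"
    using pair_span_mod[OF es(2)] by blast
  \<comment> \<open>\<open>F\<close> and the reduced placement both agree with the original
    placement modulo 1 + T^d, hence with each other.\<close>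
  have "(placed es cs + F) + (placed es cs + placed ?es cs) \<in> pair_span UNIV {d}"
    using F(2) placed_mod[OF es(1)] by (rule pair_span_add)
  also have "(placed es cs + F) + (placed es cs + placed ?es cs) = F + placed ?es cs"
    by (simp add: add_ac)
  finally have "F + placed ?es cs \<in> pair_span UNIV {d}" .
  \<comment> \<open>Residues are at most n in absolute value, and a distance or the support of a
    word adds at most another n.\<close>
  moreover have "lit F \<subseteq> ?B"
    using lit_pair_span[OF F(1)] dist_le by fastforce
  moreover have "lit (placed ?es cs) \<subseteq> ?B"
  proof -
    have eq: "placed ?es cs = (\<Sum>i<length cs. shift (?es ! i) (word_lamps (cs ! i)))"
      using es(1) by (intro placed_eq_sum) simp
    show ?thesis
      unfolding eq
    proof (rule lit_sum_subset)
      fix i assume "i \<in> {..<length cs}"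
      then have "lit (word_lamps (cs ! i)) \<subseteq> ?A" "\<bar>?es ! i\<bar> \<le> n"
        using lit_word_lamps[of "cs ! i"] cs(2)[of "cs ! i"] es(1) mod by fastforce+
      then show "lit (shift (?es ! i) (word_lamps (cs ! i))) \<subseteq> ?B"
        by (fastforce simp: lit_shift)
    qed
  qed
  ultimately have *: "F + placed ?es cs \<in> pair_span ?B {d}"
    using lit_add_subset[of F "placed ?es cs"] d(2) by (intro pair_span_single_bounded) blast+
  have "2 * int n * 1 \<le> N"
    unfolding N_def by (intro mult_left_mono) auto
  then have N: "2 * int n \<le> N" by simp
  then have sub: "?A \<subseteq> {- N..N}" "?B \<subseteq> {- N..N}" by auto
  have "F \<in> pair_span {- N..N} (distances cs)"
    using F(1) pair_span_mono[OF sub(1) subset_refl] by blast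
  moreover have "F + placed ?es cs \<in> pair_span {- N..N} (distances cs)"
    using * pair_span_mono[OF sub(2), of "{d}" "distances cs"] d(1) by blast
  ultimately have "placed ?es cs \<in> pair_span {- N..N} (distances cs)"
    by (simp add: pair_span_add_cancel)
  moreover have "\<bar>e\<bar> \<le> N" if "e \<in> set ?es" for e
  proof -
    from that obtain p where "e = p mod d" by auto
    with mod[of p] N show ?thesis by linarith
  qed
  ultimately show thesis
    using es(1) by (intro that[of ?es]) auto
qed

section \<open>A certificate-driven verifier\<close>

text \<open>\<open>Init\<close> is the phase in which the Turing machine marks its counter; abstract
  runs start in \<open>Forward\<close> and never enter it. In \<open>Hub\<close> the head returns to
  the right end, where the certificate selects the next pass.\<close>

datatype phase = Init | Forward bool | Real bool | Hub | Ghost bool | Half bool | Accept | Reject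

fun is_a :: "letter \<Rightarrow> bool" where
  "is_a Pos_a = True"
| "is_a Neg_a = True"
| "is_a _ = False"

text \<open>Words are read backwards and the lamp head follows minus the shift of the suffix read,
  so \<open>t\<close> moves it left.\<close>

fun back_move :: "letter \<Rightarrow> move" where
  "back_move Pos_t = Move_left"
| "back_move Neg_t = Move_right"
| "back_move _ = Stay"

text \<open>
  The arguments are the phase, the input symbol, whether all lamps are off, and the command read
  from the certificate. The result consists of the new phase, the move on the input, whether to
  toggle the current lamp, and the move on the lamps.

  \<open>Forward\<close> checks the format of the input. \<open>Real\<close> reads the input backwards and evaluates each
  word at a position chosen by the certificate, while its flag is the parity of the total shift.
  \<open>Ghost\<close> and \<open>Half\<close> toggle a lamp, walk backwards over the input, and toggle again: \<open>Ghost\<close>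
  follows only the words selected by the certificate, \<open>Half\<close> follows all words at half speed.
\<close>

fun trans :: "phase \<Rightarrow> letter option symbol \<Rightarrow> bool \<Rightarrow> nat \<Rightarrow> phase \<times> move \<times> bool \<times> move" where
  "trans (Forward b) Blank z k = (if b then Reject else Real False, Move_left, False, Stay)"
| "trans (Forward b) (Inp x) z k = (Forward (x \<noteq> None), Move_right, False, Stay)"
| "trans (Real b) Blank z k = (if b then Reject else Hub, Move_right, False, Stay)"
| "trans (Real b) (Inp None) z k =
    (if k = 1 then (Real b, Stay, False, Move_left)
     else if k = 2 then (Real b, Stay, False, Move_right)
     else (Real b, Move_left, False, Stay))"
| "trans (Real b) (Inp (Some l)) z k =
    (Real (b \<noteq> odd (letter_shift l)), Move_left, is_a l, back_move l)"
| "trans Hub (Inp x) z k = (Hub, Move_right, False, Stay)"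
| "trans Hub Blank z k =
    (if k = 1 then (Hub, Stay, False, Move_left)
     else if k = 2 then (Hub, Stay, False, Move_right)
     else if k = 3 then (Half False, Move_left, True, Stay)
     else if k = 4 then (if z then Accept else Reject, Stay, False, Stay)
     else (Ghost False, Move_left, True, Stay))"
| "trans (Ghost b) Blank z k = (Hub, Move_right, True, Stay)"
| "trans (Ghost b) (Inp None) z k = (Ghost (k = 1), Move_left, False, Stay)"
| "trans (Ghost b) (Inp (Some l)) z k =
    (Ghost b, Move_left, False, if b then back_move l else Stay)"
| "trans (Half b) Blank z k = (Hub, Move_right, True, Stay)"
| "trans (Half b) (Inp None) z k = (Half b, Move_left, False, Stay)"
| "trans (Half b) (Inp (Some l)) z k =
    (Half (b \<noteq> odd (letter_shift l)), Move_left, False,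
     if b = (l = Pos_t) then back_move l else Stay)"
| "trans q s z k = (Reject, Stay, False, Stay)"

text \<open>Phase, input head, lamp head, lamps.\<close>

type_synonym vconfig = "phase \<times> int \<times> int \<times> lamps"

definition input_sym :: "letter option list \<Rightarrow> int \<Rightarrow> letter option symbol" where
  "input_sym w = fst (tape_of (map Inp w))"

fun vstep :: "letter option list \<Rightarrow> nat \<Rightarrow> vconfig \<Rightarrow> vconfig" where
  "vstep w k (q, i, p, S) =
    (if q = Accept \<or> q = Reject then (q, i, p, S)
     else case trans q (input_sym w i) (S = 0) k of (q', mi, tg, mp) \<Rightarrow>
       (q', i + move_offset mi, p + move_offset mp, if tg then S + lamp p else S))"

abbreviation vrun :: "letter option list \<Rightarrow> nat list \<Rightarrow> vconfig \<Rightarrow> vconfig" where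
  "vrun w ks \<equiv> fold (vstep w) ks"

definition vstart :: vconfig where
  "vstart = (Forward False, 0, 0, 0)"

lemma input_sym_simps:
  "input_sym w (- 1) = Blank"
  "input_sym w (int (length w)) = Blank"
  "j < length w \<Longrightarrow> input_sym w (int j) = Inp (w ! j)"
  by (simp_all add: input_sym_def tape_of_def)

lemma move_offset_back_move [simp]: "move_offset (back_move l) = - letter_shift l"
  by (cases l) simp_all

subsection \<open>Soundness\<close>

fun opt_shift :: "letter option \<Rightarrow> int" where
  "opt_shift None = 0"
| "opt_shift (Some l) = letter_shift l"

definition input_shift :: "letter option list \<Rightarrow> int" where
  "input_shift v = sum_list (map opt_shift v)"

text \<open>In a backward pass this measures the part of the current word already passed; a selected
  \<open>Ghost\<close> walk has moved by minus this amount.\<close>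

fun lead_shift :: "letter option list \<Rightarrow> int" where
  "lead_shift [] = 0"
| "lead_shift (None # v) = 0"
| "lead_shift (Some l # v) = letter_shift l + lead_shift v"

lemma input_shift_simps [simp]:
  "input_shift [] = 0" "input_shift (x # v) = opt_shift x + input_shift v"
  "input_shift (u @ v) = input_shift u + input_shift v"
  by (simp_all add: input_shift_def)

text \<open>Possible outcomes of a \<open>Real\<close> pass over a suffix, with the lamp head as
  last argument. It is arbitrary after a delimiter, where the certificate may move it; this freedom
  is the choice of exponents.\<close>

inductive real_pass :: "letter option list \<Rightarrow> lamps \<Rightarrow> int \<Rightarrow> bool" where
  Nil: "real_pass [] 0 p"
| None: "real_pass v S p \<Longrightarrow> real_pass (None # v) S p'"
| Some: "real_pass v S p \<Longrightarrow>
    real_pass (Some l # v) (if is_a l then S + lamp p else S) (p - letter_shift l)"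

text \<open>Suffixes are used because the input is not yet known to be an encoding. The empty suffix
  after a final delimiter adds the distance 0, which generates only zero.\<close>

definition input_distances :: "letter option list \<Rightarrow> int set" where
  "input_distances w = insert (input_shift w div 2)
    {lead_shift v | u v. w = u @ v \<and> (u = [] \<or> last u = None)}"

text \<open>A union of cosets of the ideal, one for each outcome of a \<open>Real\<close> pass.
  Containing 0 means that some outcome lies in the ideal.\<close>

definition reachable :: "letter option list \<Rightarrow> lamps set" where
  "reachable w =
    {S. \<exists>S0 p0. real_pass w S0 p0 \<and> S + S0 \<in> pair_span UNIV (input_distances w)}"

definition proper :: "letter option list \<Rightarrow> bool" where
  "proper w \<longleftrightarrow> w = [] \<or> last w = None"

text \<open>A head moving left has not yet processed cell \<open>i\<close>, so the part already read
  begins at \<open>i + 1\<close>; for \<open>i = - 1\<close> it is the whole input.\<close>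

definition rest :: "letter option list \<Rightarrow> int \<Rightarrow> letter option list" where
  "rest w i = drop (nat (i + 1)) w"

text \<open>
  During a \<open>Ghost\<close> or \<open>Half\<close> pass, the lamp toggled at the start can be replaced, modulo pairs
  at admissible distances, by a lamp that moves with the head, up to the part of the walk that
  is still incomplete.
\<close>

fun vinv :: "letter option list \<Rightarrow> vconfig \<Rightarrow> bool" where
  "vinv w (Forward b, i, p, S) \<longleftrightarrow>
    0 \<le> i \<and> i \<le> int (length w) \<and> S = 0 \<and> (b \<longleftrightarrow> i > 0 \<and> w ! nat (i - 1) \<noteq> None)"
| "vinv w (Real b, i, p, S) \<longleftrightarrow>
    proper w \<and> - 1 \<le> i \<and> i < int (length w) \<and> b = odd (input_shift (rest w i)) \<and>
    (\<exists>p'. real_pass (rest w i) S p' \<and> (p' = p \<or> i = - 1 \<or> w ! nat i = None))"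
| "vinv w (Hub, i, p, S) \<longleftrightarrow>
    proper w \<and> even (input_shift w) \<and> 0 \<le> i \<and> i \<le> int (length w) \<and> S \<in> reachable w"
| "vinv w (Ghost b, i, p, S) \<longleftrightarrow>
    proper w \<and> even (input_shift w) \<and> - 1 \<le> i \<and> i < int (length w) \<and>
    S + lamp (p + (if b then lead_shift (rest w i) else 0)) \<in> reachable w"
| "vinv w (Half b, i, p, S) \<longleftrightarrow>
    proper w \<and> even (input_shift w) \<and> - 1 \<le> i \<and> i < int (length w) \<and>
    b = odd (input_shift (rest w i)) \<and> S + lamp (p + input_shift (rest w i) div 2) \<in> reachable w"
| "vinv w (Accept, i, p, S) \<longleftrightarrow> proper w \<and> even (input_shift w) \<and> 0 \<in> reachable w"
| "vinv w (Reject, i, p, S) \<longleftrightarrow> True"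
| "vinv w (Init, i, p, S) \<longleftrightarrow> True"

section \<open>Preservation of the invariant\<close>

lemma reachable_add:
  assumes "S \<in> reachable w" "F \<in> pair_span UNIV (input_distances w)"
  shows "S + F \<in> reachable w"
proof -
  from assms(1) obtain S0 p0 where S0: "real_pass w S0 p0"
      "S + S0 \<in> pair_span UNIV (input_distances w)"
    by (auto simp: reachable_def)
  from pair_span_add[OF this(2) assms(2)]
  have "(S + F) + S0 \<in> pair_span UNIV (input_distances w)" by (simp add: add_ac)
  with S0(1) show ?thesis by (auto simp: reachable_def)
qed

text \<open>Completes a walk: the pending lamp at its start is traded for one under the head, which
  the final toggle settles.\<close>

lemma reachable_move_lamp:
  assumes "S + lamp (p + d) \<in> reachable w" "d \<in> input_distances w"
  shows "S + lamp p \<in> reachable w"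
proof -
  have "(S + lamp (p + d)) + (lamp p + lamp (p + d)) \<in> reachable w"
    by (rule reachable_add[OF assms(1) pair_in_span[OF UNIV_I assms(2)]])
  also have "(S + lamp (p + d)) + (lamp p + lamp (p + d)) = S + lamp p"
    by (simp add: add_ac)
  finally show ?thesis .
qed

lemma rest_cases:
  assumes "- 1 \<le> i" "i < int (length w)"
  obtains "i = - 1" "input_sym w i = Blank" "rest w i = w"
  | j where "i = int j" "j < length w" "input_sym w i = Inp (w ! j)" "rest w i = drop (Suc j) w"
      "rest w (i - 1) = w ! j # rest w i"
proof (cases "i = - 1")
  case True
  then show ?thesis using that(1) by (simp add: input_sym_simps rest_def)
next
  case False
  then obtain j where j: "i = int j" "j < length w"
    using assms by (metis int_nat_eq nat_less_iff add1_zle_eq add.right_inverse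
        add.commute zle_add1_eq_le linorder_not_less order_le_less of_nat_less_iff)
  then show ?thesis
    using that(2)[of j] by (simp add: input_sym_simps rest_def nat_add_distrib Cons_nth_drop_Suc)
qed

lemma lead_shift_rest:
  assumes "j < length w" "w ! j = None"
  shows "lead_shift (drop (Suc j) w) \<in> input_distances w"
proof -
  have "w = take (Suc j) w @ drop (Suc j) w" by simp
  moreover have "last (take (Suc j) w) = None"
    using assms by (simp add: take_Suc_conv_app_nth)
  ultimately show ?thesis unfolding input_distances_def by blast
qed

lemma lead_shift_self: "lead_shift w \<in> input_distances w"
proof -
  have "w = [] @ w" by simp
  then show ?thesis unfolding input_distances_def by blast
qed

text \<open>After a suffix of shift \<open>s\<close> the head has moved by minus the floor of s/2.
  This floor changes only when \<open>t\<close> meets an odd \<open>s\<close> or its inverse meets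
  an even \<open>s\<close>; for \<open>a\<close> the move is \<open>Stay\<close> anyway.\<close>

lemma half_speed:
  "move_offset (if odd s = (l = Pos_t) then back_move l else Stay)
    = s div 2 - (letter_shift l + s) div 2"
  by (cases l; cases "odd s") (auto elim!: evenE oddE)

lemma vinv_step: "vinv w c \<Longrightarrow> vinv w (vstep w k c)"
proof -
  assume inv: "vinv w c"
  obtain q i p S where c: "c = (q, i, p, S)" by (cases c)
  show ?thesis
  proof (cases q)
    case Init
    then show ?thesis by (simp add: c)
  next
    case (Forward b)
    with inv have i: "0 \<le> i" "i \<le> int (length w)" "S = 0" "b \<longleftrightarrow> i > 0 \<and> w ! nat (i - 1) \<noteq> None"
      by (simp_all add: c)
    show ?thesis
    proof (cases "i = int (length w)")
      case True
      \<comment> \<open>The flag records whether the symbol just passed is a letter, so at the right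
        end a false flag means an empty input or a final delimiter.\<close>
      have "proper w" if "\<not> b"
        using i(4) that True by (cases w rule: rev_cases) (auto simp: proper_def)
      moreover have "rest w (int (length w) - 1) = []"
        by (simp add: rest_def)
      moreover have "w ! nat (int (length w) - 1) = None" if "\<not> b" "w \<noteq> []"
        using i(4) that True by auto
      ultimately show ?thesis
        using True i(3) real_pass.Nil[of p] by (auto simp: c Forward input_sym_simps)
    next
      case False
      then obtain j where j: "i = int j" "j < length w"
        using i(1,2) by (metis int_nat_eq nat_int of_nat_less_iff order_le_less)
      then show ?thesis
        using i(3) by (simp add: c Forward input_sym_simps)
    qed
  next
    case (Real b)
    with inv obtain p' where i: "proper w" "- 1 \<le> i" "i < int (length w)"
      "b = odd (input_shift (rest w i))" "real_pass (rest w i) S p'"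
      "p' = p \<or> i = - 1 \<or> w ! nat i = None"
      by (auto simp: c)
    from i(2,3) show ?thesis
    proof (cases rule: rest_cases)
      case 1
      have "S \<in> reachable w" if "even (input_shift w)"
        using i(5) 1(3) pair_span.zero by (force simp: reachable_def)
      then show ?thesis
        using 1 i by (simp add: c Real)
    next
      case (2 j)
      show ?thesis
      proof (cases "w ! j")
        case None
        \<comment> \<open>Here the certificate may move the lamp head, and
          \<open>real_pass.None\<close> permits every position.\<close>
        then show ?thesis
          using 2 i real_pass.None[OF i(5), of p] by (auto simp: c Real)
      next
        case (Some l)
        then have "p' = p" using i(6) 2(1) by simp
        with i(5) have "real_pass (rest w i) S p" by simp
        from real_pass.Some[OF this, of l]
        have "real_pass (rest w (i - 1)) (if is_a l then S + lamp p else S) (p - letter_shift l)"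
          using 2(5) Some by (simp split del: if_split)
        then show ?thesis
          using 2 i Some by (auto simp: c Real)
      qed
    qed
  next
    case Hub
    with inv have i: "proper w" "even (input_shift w)" "0 \<le> i" "i \<le> int (length w)" "S \<in> reachable w"
      by (simp_all add: c)
    show ?thesis
    proof (cases "i = int (length w)")
      case True
      have "rest w (int (length w) - 1) = []"
        by (simp add: rest_def)
      \<comment> \<open>The toggle that starts a walk cancels against the pending lamp, as nothing
        has been walked yet.\<close>
      moreover have "S + lamp p + lamp p = S" by (simp add: add.assoc)
      ultimately show ?thesis
        using True i by (auto simp: c Hub input_sym_simps)
    next
      case False
      then obtain j where j: "i = int j" "j < length w"
        using i(3,4) by (metis int_nat_eq nat_int of_nat_less_iff order_le_less)
      then show ?thesis
        using i by (simp add: c Hub input_sym_simps)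
    qed
  next
    case (Ghost b)
    with inv have i: "proper w" "even (input_shift w)" "- 1 \<le> i" "i < int (length w)"
      "S + lamp (p + (if b then lead_shift (rest w i) else 0)) \<in> reachable w"
      by (simp_all add: c)
    from i(3,4) show ?thesis
    proof (cases rule: rest_cases)
      case 1
      then have "S + lamp p \<in> reachable w"
        using i(5) lead_shift_self[of w] reachable_move_lamp[of S p] by (auto split: if_splits)
      then show ?thesis
        using 1 i by (simp add: c Ghost)
    next
      case (2 j)
      show ?thesis
      proof (cases "w ! j")
        case None
        \<comment> \<open>A delimiter completes the walk along a selected word, whose shift is an
          admissible distance; the flag may then be chosen anew.\<close>
        then have "S + lamp p \<in> reachable w"
          using i(5) 2 lead_shift_rest[of j w] reachable_move_lamp[of S p] by (auto split: if_splits)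
        then show ?thesis
          using 2 i None by (simp add: c Ghost)
      next
        case (Some l)
        then show ?thesis
          using 2 i by (auto simp: c Ghost)
      qed
    qed
  next
    case (Half b)
    with inv have i: "proper w" "even (input_shift w)" "- 1 \<le> i" "i < int (length w)"
      "b = odd (input_shift (rest w i))" "S + lamp (p + input_shift (rest w i) div 2) \<in> reachable w"
      by (simp_all add: c)
    from i(3,4) show ?thesis
    proof (cases rule: rest_cases)
      case 1
      have "input_shift w div 2 \<in> input_distances w"
        by (simp add: input_distances_def)
      then have "S + lamp p \<in> reachable w"
        using i(6) 1 reachable_move_lamp[of S p] by simp
      then show ?thesis
        using 1 i by (simp add: c Half)
    next
      case (2 j)
      show ?thesis
      proof (cases "w ! j")
        case None
        then show ?thesis
          using 2 i by (simp add: c Half)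
      next
        case (Some l)
        let ?s = "input_shift (rest w i)" and ?m = "if b = (l = Pos_t) then back_move l else Stay"
        have "vstep w k c = (Half (b \<noteq> odd (letter_shift l)), i - 1, p + move_offset ?m, S)"
          using 2 Some by (simp add: c Half)
        moreover have "p + move_offset ?m + input_shift (rest w (i - 1)) div 2 = p + ?s div 2"
          unfolding i(5) half_speed using 2(5) Some by simp
        then have "S + lamp (p + move_offset ?m + input_shift (rest w (i - 1)) div 2) \<in> reachable w"
          using i(6) by (simp only:)
        ultimately show ?thesis
          using 2 i Some by (auto split del: if_split)
      qed
    qed
  next
    case Accept
    then show ?thesis using inv by (simp add: c)
  next
    case Reject
    then show ?thesis using inv by (simp add: c)
  qed
qed

lemma vinv_run: "vinv w c \<Longrightarrow> vinv w (vrun w ks c)"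
  by (induction ks arbitrary: c) (simp_all add: vinv_step del: vstep.simps vinv.simps)

section \<open>From accepted inputs back to words\<close>

lemma encode_words_simps [simp]:
  "encode_words [] = []" "encode_words (c # cs) = map Some c @ None # encode_words cs"
  "encode_words (cs @ cs') = encode_words cs @ encode_words cs'"
  by (simp_all add: encode_words_def)

lemma proper_imp_encode_words: "proper w \<Longrightarrow> \<exists>cs. w = encode_words cs"
proof (induction w)
  case Nil
  show ?case by (intro exI[of _ "[]"]) simp
next
  case (Cons x w)
  have "\<exists>cs. w = encode_words cs"
    using Cons by (cases "w = []") (auto simp: proper_def)
  then obtain cs where cs: "w = encode_words cs" ..
  show ?case
  proof (cases x)
    case None
    then show ?thesis by (intro exI[of _ "[] # cs"]) (simp add: cs)
  next
    case (Some l)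
    then obtain c cs' where "cs = c # cs'"
      using Cons.prems cs by (cases cs) (auto simp: proper_def)
    then show ?thesis
      using Some cs by (intro exI[of _ "(l # c) # cs'"]) simp
  qed
qed

lemma input_shift_map_Some [simp]: "input_shift (map Some c) = word_shift c"
  by (induction c) simp_all

lemma input_shift_encode_words [simp]: "input_shift (encode_words cs) = total_shift cs"
  by (induction cs) simp_all

lemma lead_shift_map_Some [simp]: "lead_shift (map Some c @ None # v) = word_shift c"
  by (induction c) simp_all

text \<open>Cuts after a delimiter fall between words or at the very end; the end accounts for the
  0.\<close>

lemma lead_shift_encode_words:
  assumes "encode_words cs = u @ v" "u = [] \<or> last u = None"
  shows "lead_shift v \<in> insert 0 (word_shift ` set cs)"
  using assms
proof (induction cs arbitrary: u)
  case (Cons c cs)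
  show ?case
  proof (cases "u = []")
    case True
    then show ?thesis using Cons.prems(1) by auto
  next
    case False
    with Cons.prems have u: "last u = None" by simp
    from Cons.prems(1) have "map Some c @ None # encode_words cs = u @ v" by simp
    \<comment> \<open>In the first case the last symbol of \<open>u\<close> would be a letter, so
      the cut lies behind the delimiter.\<close>
    then consider us where "map Some c = u @ us"
      | us where "u = map Some c @ us" "us @ v = None # encode_words cs"
      by (auto simp: append_eq_append_conv2)
    then show ?thesis
    proof cases
      case 1
      then have "last u \<in> set (map Some c)" using False by (simp add: 1)
      then show ?thesis using u by auto
    next
      case 2
      then have "us \<noteq> []" using u False by (auto simp: last_map)
      then obtain us' where us': "us = None # us'" "encode_words cs = us' @ v"
        using 2(2) by (cases us) auto
      then have "us' = [] \<or> last us' = None" using u 2(1) by (auto split: if_splits)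
      then show ?thesis using Cons.IH[OF us'(2)] by auto
    qed
  qed
qed simp

lemma input_distances_encode_words:
  "input_distances (encode_words cs) \<subseteq> distances cs \<union> {0}"
  using lead_shift_encode_words by (fastforce simp: input_distances_def distances_def)

inductive_cases real_pass_NilE: "real_pass [] S p"
inductive_cases real_pass_NoneE: "real_pass (None # v) S p"
inductive_cases real_pass_SomeE: "real_pass (Some l # v) S p"

lemma is_a_iff: "is_a l \<longleftrightarrow> l = Pos_a \<or> l = Neg_a"
  by (cases l) simp_all

text \<open>The exponent \<open>e\<close> is the position of the lamp head when the word is entered
  from its right end.\<close>

lemma real_pass_word:
  assumes "real_pass (map Some c @ None # v) S p"
  shows "\<exists>S0 p0 e. real_pass v S0 p0 \<and> S = shift e (word_lamps c) + S0 \<and> p = e - word_shift c"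
  using assms
proof (induction c arbitrary: S p)
  case Nil
  then show ?case by (auto elim!: real_pass_NoneE)
next
  case (Cons l c)
  then obtain S1 p1 where 1: "real_pass (map Some c @ None # v) S1 p1"
    "S = (if is_a l then S1 + lamp p1 else S1)" "p = p1 - letter_shift l"
    by (auto elim!: real_pass_SomeE)
  from Cons.IH[OF 1(1)] obtain S0 p0 e where "real_pass v S0 p0"
      "S1 = shift e (word_lamps c) + S0" "p1 = e - word_shift c"
    by blast
  then show ?case
    using 1 by (intro exI[of _ S0] exI[of _ p0] exI[of _ e])
      (auto simp: is_a_iff shift_add add_ac)
qed

lemma real_pass_encode_words:
  assumes "real_pass (encode_words cs) S p"
  shows "\<exists>es. length es = length cs \<and> S = placed es cs"
  using assms
proof (induction cs arbitrary: S p)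
  case Nil
  then show ?case by (auto elim!: real_pass_NilE)
next
  case (Cons c cs)
  then obtain S0 p0 e where *: "real_pass (encode_words cs) S0 p0" "S = shift e (word_lamps c) + S0"
    using real_pass_word[of c "encode_words cs" S p] by auto
  from Cons.IH[OF *(1)] obtain es where "length es = length cs" "S0 = placed es cs" by blast
  with *(2) show ?case by (intro exI[of _ "e # es"]) simp
qed

theorem verifier_sound:
  assumes "fst (vrun w ks vstart) = Accept"
  shows "\<exists>cs. w = encode_words cs \<and> solvable cs"
proof -
  have "vinv w vstart" by (simp add: vstart_def)
  then have "vinv w (vrun w ks vstart)" by (rule vinv_run)
  then have w: "proper w" "even (input_shift w)" "0 \<in> reachable w"
    using assms by (cases "vrun w ks vstart"; simp)+
  obtain cs where cs: "w = encode_words cs"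
    using proper_imp_encode_words[OF w(1)] by blast
  obtain S p where S: "real_pass w S p" "S \<in> pair_span UNIV (input_distances w)"
    using w(3) by (auto simp: reachable_def)
  obtain es where es: "length es = length cs" "S = placed es cs"
    using real_pass_encode_words S(1) unfolding cs by blast
  have "S \<in> pair_span UNIV (distances cs \<union> {0})"
    using S(2) pair_span_mono[OF subset_refl input_distances_encode_words] unfolding cs by blast
  then have "S \<in> pair_span UNIV (distances cs)"
    using pair_span_Un pair_span_zero_distance by fastforce
  then have "solvable cs"
    using w(2) es by (auto simp: solvable_iff cs)
  with cs show ?thesis by blast
qed

subsection \<open>Completeness with short certificates\<close>

text \<open>Keeps account of the certificate length. The bound 5 matches the number of auxiliary
  symbols of \<open>verifier\<close>.\<close>

definition can :: "letter option list \<Rightarrow> nat \<Rightarrow> vconfig \<Rightarrow> vconfig \<Rightarrow> bool" where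
  "can w n c c' \<longleftrightarrow> (\<exists>ks. length ks \<le> n \<and> set ks \<subseteq> {..<5} \<and> vrun w ks c = c')"

lemma can_refl: "can w 0 c c"
  by (auto simp: can_def)

lemma can_step: "vstep w k c = c' \<Longrightarrow> k < 5 \<Longrightarrow> can w 1 c c'"
  unfolding can_def by (intro exI[of _ "[k]"]) simp

lemma can_trans:
  assumes "can w m c c'" "can w n c' c''"
  shows "can w (m + n) c c''"
proof -
  obtain ks ks' where "length ks \<le> m" "set ks \<subseteq> {..<5}" "vrun w ks c = c'"
      "length ks' \<le> n" "set ks' \<subseteq> {..<5}" "vrun w ks' c' = c''"
    using assms by (auto simp: can_def)
  then show ?thesis
    unfolding can_def by (intro exI[of _ "ks @ ks'"]) auto
qed

lemma can_mono: "can w m c c' \<Longrightarrow> m \<le> n \<Longrightarrow> can w n c c'"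
  unfolding can_def using order_trans by blast

text \<open>Serves the two situations in which commands 1 and 2 move the lamp head while the input
  head rests: \<open>Real\<close> at a delimiter and \<open>Hub\<close> at the right end.\<close>

lemma can_walk:
  assumes "\<And>p. vstep w 1 (f p) = f (p - 1)" "\<And>p. vstep w 2 (f p) = f (p + 1)"
  shows "can w (nat \<bar>p' - p\<bar>) (f p) (f p')"
proof (cases "p \<le> p'")
  case True
  then show ?thesis
  proof (induction p' rule: int_ge_induct)
    case base
    show ?case by (simp add: can_refl)
  next
    case (step q)
    have "can w 1 (f q) (f (q + 1))"
      by (rule can_step[OF assms(2)]) simp
    from can_trans[OF step.IH this] show ?case
      using step.hyps by (elim can_mono) linarith
  qed
next
  case False
  then have "p' \<le> p" by simp
  then show ?thesis
  proof (induction p' rule: int_le_induct)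
    case base
    show ?case by (simp add: can_refl)
  next
    case (step q)
    have "can w 1 (f q) (f (q - 1))"
      by (rule can_step[OF assms(1)]) simp
    from can_trans[OF step.IH this] show ?case
      using step.hyps by (elim can_mono) linarith
  qed
qed

text \<open>Common induction for leftward passes: \<open>g v' i\<close> is the configuration with
  the input head at \<open>i\<close> after the suffix \<open>v'\<close> of the segment
  \<open>v\<close> has been read.\<close>

lemma can_sweep:
  assumes "\<And>pre x v'. w = pre @ x # v' @ post \<Longrightarrow> x \<in> set v \<Longrightarrow>
      can w 1 (g v' (int (length pre))) (g (x # v') (int (length pre) - 1))"
    and "w = pre @ v @ post"
  shows "can w (length v) (g [] (int (length pre + length v) - 1)) (g v (int (length pre) - 1))"
  using assms
proof (induction v arbitrary: pre)
  case Nil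
  show ?case by (simp add: can_refl)
next
  case (Cons x v)
  have "can w (length v) (g [] (int (length (pre @ [x]) + length v) - 1))
      (g v (int (length (pre @ [x])) - 1))"
  proof (rule Cons.IH)
    fix pre' y v' assume "w = pre' @ y # v' @ post" "y \<in> set v"
    then show "can w 1 (g v' (int (length pre'))) (g (y # v') (int (length pre') - 1))"
      by (intro Cons.prems(1)) simp_all
  qed (use Cons.prems(2) in simp)
  moreover have "can w 1 (g v (int (length pre))) (g (x # v) (int (length pre) - 1))"
    using Cons.prems by simp
  ultimately show ?case
    using can_trans by fastforce
qed

section \<open>Costs of the individual passes\<close>

lemma input_sym_append: "w = pre @ x # v \<Longrightarrow> input_sym w (int (length pre)) = Inp x"
  using input_sym_simps(3)[of "length pre" w] by simp

lemma can_forward: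
  "j \<le> length w \<Longrightarrow>
    can w j (Forward False, 0, p, S) (Forward (0 < j \<and> w ! (j - 1) \<noteq> None), int j, p, S)"
proof (induction j)
  case 0
  show ?case by (simp add: can_refl)
next
  case (Suc j)
  have "can w 1 (Forward (0 < j \<and> w ! (j - 1) \<noteq> None), int j, p, S)
      (Forward (w ! j \<noteq> None), int (Suc j), p, S)"
    using Suc.prems by (intro can_step[of _ 0]) (simp_all add: input_sym_simps)
  with Suc can_trans show ?case by fastforce
qed

lemma can_hub_forward:
  "j \<le> length w \<Longrightarrow> can w j (Hub, 0, p, S) (Hub, int j, p, S)"
proof (induction j)
  case 0
  show ?case by (simp add: can_refl)
next
  case (Suc j)
  have "can w 1 (Hub, int j, p, S) (Hub, int (Suc j), p, S)"
    using Suc.prems by (intro can_step[of _ 0]) (simp_all add: input_sym_simps)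
  with Suc can_trans show ?case by fastforce
qed

lemma can_real_word:
  assumes "w = pre @ map Some c @ post"
  shows "can w (length c) (Real b, int (length pre + length c) - 1, e, S)
    (Real (b \<noteq> odd (word_shift c)), int (length pre) - 1, e - word_shift c,
     S + shift e (word_lamps c))"
proof -
  let ?g = "\<lambda>v i. (Real (b \<noteq> odd (word_shift (map the v))), i, e - word_shift (map the v),
    S + shift e (word_lamps (map the v)))"
  have "can w (length (map Some c)) (?g [] (int (length pre + length (map Some c)) - 1))
      (?g (map Some c) (int (length pre) - 1))"
  proof (rule can_sweep[OF _ assms])
    fix pre' x v' assume w: "w = pre' @ x # v' @ post" and "x \<in> set (map Some c)"
    then obtain l where l: "x = Some l" by auto
    show "can w 1 (?g v' (int (length pre'))) (?g (x # v') (int (length pre') - 1))"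
      by (rule can_step[of _ 0])
        (auto simp: input_sym_append[OF w] l is_a_iff shift_add add_ac)
  qed
  then show ?thesis by (simp add: comp_def)
qed

lemma can_ghost_word:
  assumes "w = pre @ map Some c @ post"
  shows "can w (length c) (Ghost True, int (length pre + length c) - 1, p, S)
    (Ghost True, int (length pre) - 1, p - word_shift c, S)"
proof -
  let ?g = "\<lambda>v i. (Ghost True, i, p - word_shift (map the v), S)"
  have "can w (length (map Some c)) (?g [] (int (length pre + length (map Some c)) - 1))
      (?g (map Some c) (int (length pre) - 1))"
  proof (rule can_sweep[OF _ assms])
    fix pre' x v' assume w: "w = pre' @ x # v' @ post" and "x \<in> set (map Some c)"
    then obtain l where l: "x = Some l" by auto
    show "can w 1 (?g v' (int (length pre'))) (?g (x # v') (int (length pre') - 1))"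
      by (rule can_step[of _ 0]) (auto simp: input_sym_append[OF w] l)
  qed
  then show ?thesis by (simp add: comp_def)
qed

lemma can_ghost_skip:
  assumes "w = pre @ v @ post"
  shows "can w (length v) (Ghost False, int (length pre + length v) - 1, p, S)
    (Ghost False, int (length pre) - 1, p, S)"
proof (rule can_sweep[of w post v "\<lambda>v i. (Ghost False, i, p, S)", OF _ assms])
  fix pre' x v' assume w: "w = pre' @ x # v' @ post"
  show "can w 1 (Ghost False, int (length pre'), p, S) (Ghost False, int (length pre') - 1, p, S)"
    by (rule can_step[of _ 0]; cases x) (auto simp: input_sym_append[OF w])
qed

lemma can_half_pass:
  "can w (length w) (Half False, int (length w) - 1, p, S)
    (Half (odd (input_shift w)), - 1, p - input_shift w div 2, S)"
proof -
  let ?g = "\<lambda>v i. (Half (odd (input_shift v)), i, p - input_shift v div 2, S)"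
  have "can w (length w) (?g [] (int (length ([] :: letter option list) + length w) - 1))
      (?g w (int (length ([] :: letter option list)) - 1))"
  proof (rule can_sweep[of w "[]" w ?g "[]"])
    fix pre' x v' assume w: "w = pre' @ x # v' @ []"
    show "can w 1 (?g v' (int (length pre'))) (?g (x # v') (int (length pre') - 1))"
    proof (cases x)
      case None
      then show ?thesis
        by (intro can_step[of _ 0]) (auto simp: input_sym_append[OF w])
    next
      case (Some l)
      then show ?thesis
        using half_speed[of "input_shift v'" l]
        by (intro can_step[of _ 0]) (auto simp: input_sym_append[OF w] split del: if_split)
    qed
  qed simp
  then show ?thesis by simp
qed

text \<open>Words are processed from last to first. Before each one the lamp head walks from a
  position within N + n to an exponent within N, at cost at most 2N + n.\<close>

lemma can_real_pass:
  fixes N n :: nat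
  assumes "length es = length cs" "w = pre @ encode_words cs"
    and "\<And>e. e \<in> set es \<Longrightarrow> \<bar>e\<bar> \<le> int N" "\<And>c. c \<in> set cs \<Longrightarrow> length c \<le> n"
  shows "\<exists>p. \<bar>p\<bar> \<le> int (N + n) \<and>
    can w (length (encode_words cs) + length cs * (2 * N + n)) (Real False, int (length w) - 1, 0, 0)
      (Real (odd (total_shift cs)), int (length pre) - 1, p, placed es cs)"
  using assms
proof (induction es cs arbitrary: pre rule: list_induct2)
  case Nil
  then show ?case by (intro exI[of _ 0]) (simp add: can_refl)
next
  case (Cons e es c cs)
  let ?v = "encode_words cs" and ?b = "odd (total_shift cs)" and ?S = "placed es cs"
  let ?i = "int (length (pre @ map Some c))"
  have "w = (pre @ map Some c @ [None]) @ ?v" using Cons.prems by simp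
  from Cons.IH[OF this] Cons.prems obtain p where p: "\<bar>p\<bar> \<le> int (N + n)"
    "can w (length ?v + length cs * (2 * N + n)) (Real False, int (length w) - 1, 0, 0)
      (Real ?b, ?i, p, ?S)"
    by auto
  have w: "w = (pre @ map Some c) @ None # ?v" "w = pre @ map Some c @ None # ?v"
    using Cons.prems by simp_all
  note sym = input_sym_append[OF w(1)]
  have "can w (nat \<bar>e - p\<bar>) (Real ?b, ?i, p, ?S) (Real ?b, ?i, e, ?S)"
    by (rule can_walk[where f = "\<lambda>p. (Real ?b, ?i, p, ?S)"]) (simp_all only: vstep.simps sym, simp_all)
  then have "can w (2 * N + n) (Real ?b, ?i, p, ?S) (Real ?b, ?i, e, ?S)"
    using p(1) Cons.prems(2)[of e] by (elim can_mono) simp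
  note to_e = can_trans[OF p(2) this]
  have "can w 1 (Real ?b, ?i, e, ?S) (Real ?b, ?i - 1, e, ?S)"
    by (rule can_step[of _ 0]) (simp_all only: vstep.simps sym, simp_all)
  note to_word = can_trans[OF to_e this]
  have "can w (length c) (Real ?b, ?i - 1, e, ?S)
      (Real (odd (total_shift (c # cs))), int (length pre) - 1, e - word_shift c,
       placed (e # es) (c # cs))"
    using can_real_word[OF w(2), of ?b e ?S] by (simp add: add.commute)
  note final = can_trans[OF to_word this]
  have "\<bar>e - word_shift c\<bar> \<le> int (N + n)"
    using Cons.prems(2)[of e] Cons.prems(3)[of c] abs_word_shift_le[of c] by simp
  moreover have "length ?v + length cs * (2 * N + n) + (2 * N + n) + 1 + length c
      = length (encode_words (c # cs)) + length (c # cs) * (2 * N + n)"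
    by simp
  ultimately show ?case
    using final by (intro exI[of _ "e - word_shift c"]) (simp only: simp_thms)
qed

text \<open>A round trip: one step starts the pass, \<open>length w\<close> steps reach the left
  end, one step returns to \<open>Hub\<close>, and \<open>length w\<close> steps lead back. Reading
  backwards puts the second lamp at \<open>p - d\<close>.\<close>

lemma can_pair:
  assumes w: "w = encode_words cs" and d: "d \<in> distances cs" "even (total_shift cs)"
  shows "can w (2 * length w + 2) (Hub, int (length w), p, S)
    (Hub, int (length w), p - d, S + (lamp p + lamp (p - d)))"
proof -
  let ?n = "length w" and ?S = "S + lamp p"
  \<comment> \<open>Which phase arrives depends on the pass; at the left blank all three toggle and
    return to \<open>Hub\<close>.\<close>
  have "\<exists>q. can w (1 + ?n) (Hub, int ?n, p, S) (q, - 1, p - d, ?S) \<and>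
      (q = Half False \<or> q = Ghost False \<or> q = Ghost True)"
  proof (cases "d = total_shift cs div 2")
    case True
    have "can w 1 (Hub, int ?n, p, S) (Half False, int ?n - 1, p, ?S)"
      by (rule can_step[of _ 3]) (simp_all add: input_sym_simps)
    from can_trans[OF this can_half_pass] show ?thesis
      using d(2) by (intro exI[of _ "Half False"]) (simp add: True w)
  next
    case False
    with d obtain c where "c \<in> set cs" and dc: "d = word_shift c"
      by (auto simp: distances_def)
    then obtain cs1 cs2 where "cs = cs1 @ c # cs2"
      by (meson split_list)
    define pre post where "pre = encode_words cs1" and "post = encode_words cs2"
    have w': "w = pre @ map Some c @ None # post" "w = (pre @ map Some c) @ None # post"
        "w = (pre @ map Some c @ [None]) @ post @ []"
      using \<open>cs = _\<close> by (simp_all add: w pre_def post_def)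
    let ?i = "int (length (pre @ map Some c))"
    have "can w 1 (Hub, int ?n, p, S) (Ghost False, int ?n - 1, p, ?S)"
      by (rule can_step[of _ 0]) (simp_all add: input_sym_simps)
    \<comment> \<open>Later words are skipped, and command 1 at the delimiter behind
      \<open>c\<close> then selects \<open>c\<close>.\<close>
    moreover have "can w (length post) (Ghost False, int ?n - 1, p, ?S) (Ghost False, ?i, p, ?S)"
      using can_ghost_skip[OF w'(3)] by (simp add: w'(1) algebra_simps)
    ultimately have "can w (1 + length post) (Hub, int ?n, p, S) (Ghost False, ?i, p, ?S)"
      by (rule can_trans)
    moreover have "can w 1 (Ghost False, ?i, p, ?S) (Ghost True, ?i - 1, p, ?S)"
      by (rule can_step[of _ 1]) (simp_all only: vstep.simps input_sym_append[OF w'(2)], simp_all)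
    ultimately have "can w (1 + length post + 1) (Hub, int ?n, p, S) (Ghost True, ?i - 1, p, ?S)"
      by (rule can_trans)
    moreover have "can w (length c) (Ghost True, ?i - 1, p, ?S)
        (Ghost True, int (length pre) - 1, p - d, ?S)"
      using can_ghost_word[OF w'(1)] by (simp add: dc)
    ultimately have to_pre: "can w (1 + length post + 1 + length c) (Hub, int ?n, p, S)
        (Ghost True, int (length pre) - 1, p - d, ?S)"
      by (rule can_trans)
    show ?thesis
    proof (cases "pre = []")
      case True
      with to_pre show ?thesis
        by (intro exI[of _ "Ghost True"]) (auto simp: w'(1) elim: can_mono)
    next
      case False
      \<comment> \<open>Command 0 at the delimiter before \<open>c\<close> ends the walk, so the
        earlier words are skipped as well.\<close>
      then obtain pre' where pre': "pre = pre' @ [None]"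
        unfolding pre_def by (cases cs1 rule: rev_cases) auto
      have sym: "input_sym w (int (length pre')) = Inp None"
        by (rule input_sym_append[of _ _ _ "map Some c @ None # post"]) (simp add: w'(1) pre')
      have "can w 1 (Ghost True, int (length pre) - 1, p - d, ?S)
          (Ghost False, int (length pre') - 1, p - d, ?S)"
        by (rule can_step[of _ 0]) (simp_all add: pre' sym)
      note can_trans[OF to_pre this]
      moreover have "can w (length pre') (Ghost False, int (length pre') - 1, p - d, ?S)
          (Ghost False, - 1, p - d, ?S)"
        using can_ghost_skip[of w "[]" pre' "None # map Some c @ None # post"]
        by (simp add: w'(1) pre')
      ultimately have "can w (1 + length post + 1 + length c + 1 + length pre') (Hub, int ?n, p, S)
          (Ghost False, - 1, p - d, ?S)"
        by (rule can_trans)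
      then show ?thesis
        by (intro exI[of _ "Ghost False"]) (auto simp: w'(1) pre' elim: can_mono)
    qed
  qed
  then obtain q where q: "can w (1 + ?n) (Hub, int ?n, p, S) (q, - 1, p - d, ?S)"
      "q = Half False \<or> q = Ghost False \<or> q = Ghost True"
    by blast
  have "can w 1 (q, - 1, p - d, ?S) (Hub, 0, p - d, ?S + lamp (p - d))"
    using q(2) by (intro can_step[of _ 0]) (auto simp: input_sym_simps)
  note can_trans[OF can_trans[OF q(1) this] can_hub_forward[OF order_refl]]
  moreover have "?S + lamp (p - d) = S + (lamp p + lamp (p - d))"
    by (rule add.assoc)
  moreover have "1 + ?n + 1 + ?n = 2 * ?n + 2"
    by simp
  ultimately show ?thesis by (simp only:)
qed

text \<open>\<open>N'\<close> leaves room for the initial position \<open>x\<close>, which the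
  \<open>Real\<close> pass may leave outside the range given by \<open>N\<close>.\<close>

lemma can_pairs:
  fixes N n :: nat
  assumes w: "w = encode_words cs" and even: "even (total_shift cs)"
    and n: "\<And>d. d \<in> distances cs \<Longrightarrow> \<bar>d\<bar> \<le> int n"
    and Q: "finite Q" "Q \<subseteq> {- int N..int N} \<times> distances cs" and x: "\<bar>x\<bar> \<le> int N'"
    and "N \<le> N'"
  shows "\<exists>x'. \<bar>x'\<bar> \<le> int N' \<and>
    can w (card Q * (2 * N' + n + (2 * length w + 2))) (Hub, int (length w), x, S)
      (Hub, int (length w), x', S + (\<Sum>(p, d)\<in>Q. lamp p + lamp (p + d)))"
  using Q
proof (induction Q rule: finite_induct)
  case empty
  then show ?case using x by (intro exI[of _ x]) (simp add: can_refl)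
next
  case (insert pd Q)
  obtain p d where pd: "pd = (p, d)" by (cases pd)
  let ?n = "length w" and ?S = "S + (\<Sum>(p, d)\<in>Q. lamp p + lamp (p + d))"
  from insert obtain y where y: "\<bar>y\<bar> \<le> int N'"
      "can w (card Q * (2 * N' + n + (2 * ?n + 2))) (Hub, int ?n, x, S) (Hub, int ?n, y, ?S)"
    by auto
  have p: "\<bar>p\<bar> \<le> int N'" "d \<in> distances cs" "\<bar>d\<bar> \<le> int n"
    using insert.prems n \<open>N \<le> N'\<close> by (auto simp: pd)
  \<comment> \<open>The pass changes the lamp position by \<open>- d\<close>, so it starts at
    \<open>p + d\<close> in order to end at \<open>p\<close>.\<close>
  have "can w (nat \<bar>(p + d) - y\<bar>) (Hub, int ?n, y, ?S) (Hub, int ?n, p + d, ?S)"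
    by (rule can_walk[where f = "\<lambda>p. (Hub, int ?n, p, ?S)"]) (simp_all add: input_sym_simps)
  then have "can w (2 * N' + n) (Hub, int ?n, y, ?S) (Hub, int ?n, p + d, ?S)"
    using y(1) p by (elim can_mono) simp
  from can_trans[OF y(2) can_trans[OF this can_pair[OF w p(2) even]]]
  have "can w (card Q * (2 * N' + n + (2 * ?n + 2)) + (2 * N' + n + (2 * ?n + 2)))
      (Hub, int ?n, x, S) (Hub, int ?n, p, ?S + (lamp (p + d) + lamp p))"
    by simp
  moreover have "?S + (lamp (p + d) + lamp p) = S + (\<Sum>(p, d)\<in>insert pd Q. lamp p + lamp (p + d))"
    unfolding sum.insert[OF insert.hyps] by (simp add: pd add_ac)
  moreover have "card Q * (2 * N' + n + (2 * ?n + 2)) + (2 * N' + n + (2 * ?n + 2))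
      = card (insert pd Q) * (2 * N' + n + (2 * ?n + 2))"
    using insert.hyps by simp
  ultimately show ?case
    using p(1) by (intro exI[of _ p]) (simp only: simp_thms)
qed

section \<open>Length of an accepting certificate\<close>

lemma length_encode_words: "length (encode_words cs) = sum_list (map length cs) + length cs"
  by (induction cs) simp_all

lemma abs_total_shift_le: "\<bar>total_shift cs\<bar> \<le> int (length (encode_words cs))"
proof (induction cs)
  case (Cons c cs)
  then show ?case using abs_word_shift_le[of c] by simp
qed simp

text \<open>In order: the \<open>Forward\<close> pass and its turn, the \<open>Real\<close> pass
  with its walks and its turn, the way back to the right end, at most (2N + 1)(n + 1) pairs with
  their walks, and the final test.\<close>

definition cert_bound :: "nat \<Rightarrow> nat" where
  "cert_bound n = (let N = 2 * n * (n + 1) in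
    n + 1 + (n + n * (2 * N + n)) + 1 + n
    + (2 * N + 1) * (n + 1) * (2 * (N + n) + n + (2 * n + 2)) + 1)"

theorem verifier_complete:
  assumes "solvable cs"
  shows "\<exists>ks. length ks \<le> cert_bound (length (encode_words cs)) \<and> set ks \<subseteq> {..<5}
    \<and> fst (vrun (encode_words cs) ks vstart) = Accept"
proof -
  define w where "w = encode_words cs"
  define n where "n = length w"
  define N where "N = 2 * n * (n + 1)"
  from assms obtain es0 where even: "even (total_shift cs)" and es0: "length es0 = length cs"
      "placed es0 cs \<in> pair_span UNIV (distances cs)"
    by (auto simp: solvable_iff)
  have len: "length cs \<le> n" "\<bar>total_shift cs\<bar> \<le> int n"
    using abs_total_shift_le[of cs] by (simp_all add: n_def w_def length_encode_words)
  have len_c: "length c \<le> n" if "c \<in> set cs" for c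
    using that by (simp add: n_def w_def length_encode_words member_le_sum_list trans_le_add1)
  have dist: "\<bar>d\<bar> \<le> int n" if "d \<in> distances cs" for d
  proof (cases "d = total_shift cs div 2")
    case True
    then show ?thesis using len(2) by linarith
  next
    case False
    with that obtain c where "c \<in> set cs" "d = word_shift c" by (auto simp: distances_def)
    then show ?thesis using abs_word_shift_le[of c] len_c[of c] by linarith
  qed
  have N_int: "2 * int n * (int n + 1) = int N"
    by (simp add: N_def algebra_simps)
  obtain es where es: "length es = length cs" "\<And>e. e \<in> set es \<Longrightarrow> \<bar>e\<bar> \<le> int N"
      "placed es cs \<in> pair_span {- int N..int N} (distances cs)"
    using bounded_solution[OF es0 len(1) len_c len(2)] unfolding N_int by metis
  obtain Q where Q: "finite Q" "Q \<subseteq> {- int N..int N} \<times> distances cs"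
      "placed es cs = (\<Sum>(p, d)\<in>Q. lamp p + lamp (p + d))"
    using es(3) by (rule pair_span_eq_sum)
  have "can w n vstart (Forward (0 < n \<and> w ! (n - 1) \<noteq> None), int n, 0, 0)"
    using can_forward[of n w] by (simp add: vstart_def n_def)
  moreover have "(0 < n \<and> w ! (n - 1) \<noteq> None) = False"
    unfolding n_def w_def by (cases cs rule: rev_cases) (auto simp: nth_append)
  ultimately have "can w n vstart (Forward False, int n, 0, 0)"
    by (simp only:)
  moreover have "can w 1 (Forward False, int n, 0, 0) (Real False, int n - 1, 0, 0)"
    by (rule can_step[of _ 0]) (simp_all add: input_sym_simps n_def)
  ultimately have to_real: "can w (n + 1) vstart (Real False, int n - 1, 0, 0)"
    by (rule can_trans)
  obtain x where x: "\<bar>x\<bar> \<le> int (N + n)"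
      "can w (n + length cs * (2 * N + n)) (Real False, int n - 1, 0, 0)
        (Real False, - 1, x, placed es cs)"
    using can_real_pass[OF es(1), of w "[]" N n] es(2) len_c even by (auto simp: w_def n_def)
  have "n + length cs * (2 * N + n) \<le> n + n * (2 * N + n)"
    using len(1) by (intro add_left_mono mult_right_mono) auto
  then have "can w (n + n * (2 * N + n)) (Real False, int n - 1, 0, 0)
      (Real False, - 1, x, placed es cs)"
    by (rule can_mono[OF x(2)])
  note to_left = can_trans[OF to_real this]
  have "can w 1 (Real False, - 1, x, placed es cs) (Hub, 0, x, placed es cs)"
    by (rule can_step[of _ 0]) (simp_all add: input_sym_simps)
  note can_trans[OF to_left this]
  moreover have "can w n (Hub, 0, x, placed es cs) (Hub, int n, x, placed es cs)"
    by (rule can_hub_forward) (simp add: n_def)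
  ultimately have to_hub: "can w (n + 1 + (n + n * (2 * N + n)) + 1 + n) vstart
      (Hub, int n, x, placed es cs)"
    by (rule can_trans)
  obtain x' where x': "can w (card Q * (2 * (N + n) + n + (2 * n + 2)))
      (Hub, int n, x, placed es cs) (Hub, int n, x', 0)"
    using can_pairs[OF w_def even dist Q(1,2) x(1), of "placed es cs"]
    unfolding n_def[symmetric] Q(3)[symmetric] by auto
  have "card (distances cs) \<le> Suc (card (word_shift ` set cs))"
    unfolding distances_def by (rule card_insert_le_m1) simp_all
  also have "\<dots> \<le> n + 1"
    using card_image_le[of "set cs" word_shift] card_length[of cs] len(1) by simp
  finally have card_dist: "card (distances cs) \<le> n + 1" .
  have "finite (distances cs)" by (simp add: distances_def)
  then have "card Q \<le> card ({- int N..int N} \<times> distances cs)"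
    using Q(2) by (intro card_mono) simp_all
  also have "\<dots> = (2 * N + 1) * card (distances cs)"
    by (simp add: card_cartesian_product nat_add_distrib nat_mult_distrib)
  also have "\<dots> \<le> (2 * N + 1) * (n + 1)"
    using card_dist by (rule mult_left_mono) simp
  finally have "card Q \<le> (2 * N + 1) * (n + 1)" .
  then have "card Q * (2 * (N + n) + n + (2 * n + 2))
      \<le> (2 * N + 1) * (n + 1) * (2 * (N + n) + n + (2 * n + 2))"
    by (rule mult_right_mono) simp
  note can_trans[OF to_hub can_mono[OF x' this]]
  moreover have "can w 1 (Hub, int n, x', 0) (Accept, int n, x', 0)"
    by (rule can_step[of _ 4]) (simp_all add: input_sym_simps n_def)
  ultimately have "can w (n + 1 + (n + n * (2 * N + n)) + 1 + n
      + (2 * N + 1) * (n + 1) * (2 * (N + n) + n + (2 * n + 2)) + 1)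
      vstart (Accept, int n, x', 0)"
    by (rule can_trans)
  then have "can w (cert_bound n) vstart (Accept, int n, x', 0)"
    by (simp only: cert_bound_def Let_def N_def)
  then show ?thesis
    unfolding can_def n_def w_def by (metis fst_conv)
qed

section \<open>The verifier as a Turing machine\<close>

fun code :: "phase \<Rightarrow> nat" where
  "code Init = 0"
| "code Hub = 1"
| "code Accept = 2"
| "code Reject = 3"
| "code (Forward b) = 4 + of_bool b"
| "code (Real b) = 6 + of_bool b"
| "code (Ghost b) = 8 + of_bool b"
| "code (Half b) = 10 + of_bool b"

lemma code_less: "code q < 12"
  by (cases q) auto

lemma inj_code: "inj code"
proof (rule injI)
  fix q q' assume "code q = code q'"
  then show "q = q'" by (cases q; cases q') (auto split: if_splits simp: of_bool_def)
qed

lemma the_inv_code [simp]: "the_inv code (code q) = q"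
  by (rule the_inv_f_f[OF inj_code])

lemma code_eq_iff [simp]: "code q = code q' \<longleftrightarrow> q = q'"
  by (rule inj_eq[OF inj_code])

declare code.simps [simp del]

text \<open>Certificates may contain any nonblank symbols; reading those other than
  \<open>Aux\<close> as command 0 lets every certificate drive an abstract run.\<close>

fun command :: "'a symbol \<Rightarrow> nat" where
  "command (Aux k) = k"
| "command _ = 0"

text \<open>
  The tapes are the input, the certificate, the lamps, and a counter whose head stands at the
  number of lit lamps. Cell \<open>0\<close> of the counter is marked in the first step, so that the
  machine can see whether all lamps are off.
\<close>

definition verifier_delta ::
    "nat \<Rightarrow> letter option symbol list \<Rightarrow> nat \<times> (letter option symbol \<times> move) list" where
  "verifier_delta q ss =
    (if q = code Init then
       (code (Forward False), [(ss ! 0, Stay), (ss ! 1, Stay), (ss ! 2, Stay), (Aux 0, Stay)])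
     else if ss ! 1 = Blank then (code Reject, map (\<lambda>s. (s, Stay)) ss)
     else case trans (the_inv code q) (ss ! 0) (ss ! 3 = Aux 0) (command (ss ! 1)) of (q', mi, tg, mp) \<Rightarrow>
       (code q',
        [(ss ! 0, mi), (ss ! 1, Move_right),
         (if tg then if ss ! 2 = Blank then Aux 0 else Blank else ss ! 2, mp),
         (ss ! 3, if tg then if ss ! 2 = Blank then Move_right else Move_left else Stay)]))"

definition verifier :: "letter option tm" where
  "verifier =
    \<lparr>num_tapes = 4, num_states = 12, num_aux = 5, start_state = code Init,
     accept_state = code Accept, reject_state = code Reject, delta = verifier_delta\<rparr>"

lemma verifier_simps [simp]:
  "num_tapes verifier = 4" "num_states verifier = 12" "num_aux verifier = 5"
  "start_state verifier = code Init" "accept_state verifier = code Accept"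
  "reject_state verifier = code Reject" "delta verifier = verifier_delta"
  by (simp_all add: verifier_def)

lemma halted_verifier_iff:
  "halted verifier (code q, tps) \<longleftrightarrow> q = Accept \<or> q = Reject"
  by (simp only: halted_def verifier_simps fst_conv code_eq_iff)

lemma wf_verifier: "wf_tm verifier"
proof -
  have "Blank \<in> tape_alphabet verifier" "Aux 0 \<in> tape_alphabet verifier"
    by (auto simp: tape_alphabet_def)
  moreover have "s \<in> tape_alphabet verifier"
    if "set ss \<subseteq> tape_alphabet verifier" "length ss = 4" "s = ss ! i" "i < 4" for ss s i
    using that by (metis nth_mem subset_code(1))
  ultimately have delta: "fst (verifier_delta q ss) < 12 \<and> length (snd (verifier_delta q ss)) = 4 \<and>
      fst ` set (snd (verifier_delta q ss)) \<subseteq> tape_alphabet verifier"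
    if "length ss = 4" "set ss \<subseteq> tape_alphabet verifier" for q ss
    using that code_less
    by (auto simp: verifier_delta_def image_image split: prod.split)
  have "let (q', acts) = verifier_delta q ss in
      q' < 12 \<and> length acts = 4 \<and> fst ` set acts \<subseteq> tape_alphabet verifier"
    if "length ss = 4" "set ss \<subseteq> tape_alphabet verifier" for q ss
    using delta[OF that, of q] by (simp add: case_prod_unfold)
  then show ?thesis
    unfolding wf_tm_def using code_less by simp
qed

definition lamp_tape :: "lamps \<Rightarrow> int \<Rightarrow> letter option symbol" where
  "lamp_tape S x = (if S x = 0 then Blank else Aux 0)"

definition counter_tape :: "int \<Rightarrow> letter option symbol" where
  "counter_tape = (\<lambda>_. Blank)(0 := Aux 0)"

fun represent ::
    "letter option list \<Rightarrow> letter option symbol list \<Rightarrow> int \<Rightarrow> vconfig \<Rightarrow> letter option config" where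
  "represent w u j (q, i, p, S) =
    (code q, [(input_sym w, i), (fst (tape_of u), j), (lamp_tape S, p),
      (counter_tape, int (card (lit S)))])"

lemma lamp_tape_toggle:
  "(lamp_tape S)(p := if lamp_tape S p = Blank then Aux 0 else Blank) = lamp_tape (S + lamp p)"
  by (cases "S p") (auto simp: fun_eq_iff lamp_tape_def lamp_def plus_fun_apply)

lemma counter_toggle:
  assumes "finite (lit S)"
  shows "int (card (lit S)) + move_offset (if lamp_tape S p = Blank then Move_right else Move_left)
    = int (card (lit (S + lamp p)))"
proof (cases "p \<in> lit S")
  case True
  then have "card (lit S) > 0"
    using assms card_gt_0_iff by blast
  with True assms show ?thesis
    by (simp add: lit_toggle_off lamp_tape_def in_lit_iff)
next
  case False
  with assms show ?thesis
    by (simp add: lit_toggle_on lamp_tape_def not_in_lit_iff)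
qed

lemma counter_tape_iff:
  "finite (lit S) \<Longrightarrow> counter_tape (int (card (lit S))) = Aux 0 \<longleftrightarrow> S = 0"
  by (auto simp: counter_tape_def lit_eq_empty_iff)

text \<open>A toggle on the lamp tape is matched by a move of the counter head, so the mark is seen
  exactly when all lamps are off and \<open>trans\<close> receives the correct test.\<close>

lemma tm_step_represent:
  assumes "finite (lit S)" "q \<noteq> Init" "q \<noteq> Accept" "q \<noteq> Reject" "fst (tape_of u) j \<noteq> Blank"
  shows "tm_step verifier (represent w u j (q, i, p, S))
    = represent w u (j + 1) (vstep w (command (fst (tape_of u) j)) (q, i, p, S))"
proof -
  let ?s = "fst (tape_of u) j"
  obtain q' mi tg mp where tr: "trans q (input_sym w i) (S = 0) (command ?s) = (q', mi, tg, mp)"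
    by (metis prod_cases4)
  have "delta verifier (code q) (map read_tape (snd (represent w u j (q, i, p, S)))) =
    (code q', [(input_sym w i, mi), (?s, Move_right),
      (if tg then if lamp_tape S p = Blank then Aux 0 else Blank else lamp_tape S p, mp),
      (counter_tape (int (card (lit S))),
       if tg then if lamp_tape S p = Blank then Move_right else Move_left else Stay)])"
    using assms by (simp add: verifier_delta_def read_tape_def counter_tape_iff tr)
  moreover have "\<not> halted verifier (represent w u j (q, i, p, S))"
    using assms by (simp add: halted_verifier_iff del: verifier_simps)
  ultimately show ?thesis
    using assms tr counter_toggle[OF assms(1), of p]
    by (simp add: tm_step_def lamp_tape_toggle split del: if_split) (simp add: lamp_tape_toggle)
qed

text \<open>An exhausted certificate leads to rejection, which forces the machine to halt.\<close>

lemma tm_step_represent_Blank: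
  assumes "q \<noteq> Init" "q \<noteq> Accept" "q \<noteq> Reject" "fst (tape_of u) j = Blank"
  shows "fst (tm_step verifier (represent w u j (q, i, p, S))) = code Reject"
  using assms
  by (simp add: tm_step_def halted_verifier_iff verifier_delta_def read_tape_def)

section \<open>Whole runs of the machine\<close>

lemma tm_step_halted: "halted M cfg \<Longrightarrow> tm_step M cfg = cfg"
  by (simp add: tm_step_def)

lemma tm_run_Suc: "tm_run M w u (Suc n) = tm_step M (tm_run M w u n)"
  by (simp add: tm_run_def)

lemma tm_run_halted:
  assumes "halted M (tm_run M w u m)" "m \<le> n"
  shows "tm_run M w u n = tm_run M w u m"
  using assms(2)
proof (induction n rule: dec_induct)
  case (step n)
  then show ?case using assms(1) by (simp add: tm_run_Suc tm_step_halted)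
qed simp

lemma act_tape_eq: "act_tape tp a = ((fst tp)(snd tp := fst a), snd tp + move_offset (snd a))"
  by (cases tp; cases a) simp

lemma tm_run_first: "tm_run verifier w u (Suc 0) = represent w u 0 vstart"
proof -
  have "lamp_tape 0 = fst (tape_of [])" "counter_tape = (fst (tape_of []))(0 := Aux 0)"
    by (simp_all add: fun_eq_iff lamp_tape_def counter_tape_def tape_of_def zero_fun_apply)
  moreover have "snd (tape_of ss) = 0" for ss :: "letter option symbol list"
    by (simp add: tape_of_def)
  moreover have "\<not> halted verifier (initial_config verifier w u)"
    unfolding initial_config_def verifier_simps halted_verifier_iff by simp
  ultimately show ?thesis
    by (simp add: tm_run_def tm_step_def initial_config_def verifier_delta_def read_tape_def
        vstart_def numeral_2_eq_2 input_sym_def act_tape_eq prod_eq_iff)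
qed

lemma vstep_finite_lit:
  assumes "finite (lit (snd (snd (snd c))))"
  shows "finite (lit (snd (snd (snd (vstep w k c)))))"
  using assms by (cases c) (auto simp: finite_lit_add split: prod.split)

lemma vrun_finite_lit: "finite (lit (snd (snd (snd (vrun w ks vstart)))))"
proof (induction ks rule: rev_induct)
  case (snoc k ks)
  then show ?case using vstep_finite_lit by simp
qed (simp add: vstart_def)

lemma trans_not_Init: "fst (trans q s z k) \<noteq> Init"
  by (cases "(q, s, z, k)" rule: trans.cases) auto

lemma vrun_not_Init: "fst (vrun w ks vstart) \<noteq> Init"
proof (induction ks rule: rev_induct)
  case (snoc k ks)
  obtain q i p S where c: "vrun w ks vstart = (q, i, p, S)"
    by (metis prod_cases4)
  show ?case
    using snoc trans_not_Init[of q "input_sym w i" "S = 0" k] by (auto simp: c split: prod.split)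
qed (simp add: vstart_def)

text \<open>\<open>Suc\<close> counts the marking step. After halting the certificate head stands
  still, so its position is asserted only for running phases.\<close>

lemma tm_run_represent:
  assumes "Blank \<notin> set u" "n \<le> length u"
  shows "\<exists>j. tm_run verifier w u (Suc n) = represent w u j (vrun w (map command (take n u)) vstart) \<and>
    (fst (vrun w (map command (take n u)) vstart) \<notin> {Accept, Reject} \<longrightarrow> j = int n)"
  using assms(2)
proof (induction n)
  case 0
  show ?case by (intro exI[of _ 0]) (simp add: tm_run_first)
next
  case (Suc n)
  define c where "c = vrun w (map command (take n u)) vstart"
  obtain q i p S where qips: "c = (q, i, p, S)" by (cases c)
  have fin: "finite (lit S)" and init: "q \<noteq> Init"
    using vrun_finite_lit[of w "map command (take n u)"] vrun_not_Init[of w "map command (take n u)"]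
    by (simp_all add: c_def[symmetric] qips)
  have next_c: "vrun w (map command (take (Suc n) u)) vstart = vstep w (command (u ! n)) c"
    using Suc.prems by (simp add: take_Suc_conv_app_nth c_def)
  from Suc obtain j where j: "tm_run verifier w u (Suc n) = represent w u j c"
      "q \<notin> {Accept, Reject} \<longrightarrow> j = int n"
    unfolding c_def[symmetric] qips by auto
  show ?case
  proof (cases "q \<in> {Accept, Reject}")
    case True
    then have "halted verifier (represent w u j c)"
      by (auto simp: qips halted_verifier_iff)
    then have "tm_run verifier w u (Suc (Suc n)) = represent w u j c"
      unfolding tm_run_Suc[of _ _ _ "Suc n"] j(1) by (rule tm_step_halted)
    moreover have "vstep w (command (u ! n)) c = c"
      using True by (auto simp: qips)
    ultimately show ?thesis
      unfolding next_c using True by (auto simp: qips)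
  next
    case False
    have u: "fst (tape_of u) (int n) = u ! n"
      using Suc.prems by (simp add: tape_of_def)
    moreover have "u ! n \<noteq> Blank"
      using assms(1) Suc.prems by (metis Suc_le_lessD nth_mem)
    ultimately have "tm_step verifier (represent w u (int n) c)
        = represent w u (int n + 1) (vstep w (command (u ! n)) c)"
      using tm_step_represent[OF fin init, of u "int n" w i p] False by (simp add: qips)
    then have "tm_run verifier w u (Suc (Suc n))
        = represent w u (int (Suc n)) (vstep w (command (u ! n)) c)"
      using j False by (simp add: tm_run_Suc[of _ _ _ "Suc n"] add.commute)
    then show ?thesis
      unfolding next_c by blast
  qed
qed

text \<open>The two extra steps mark the counter and meet the blank behind the certificate.\<close>

lemma tm_run_verifier_final:
  assumes "Blank \<notin> set u" "n \<ge> length u + 2"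
  shows "fst (tm_run verifier w u n) =
    (if fst (vrun w (map command u) vstart) = Accept then code Accept else code Reject)"
proof -
  define c where "c = vrun w (map command u) vstart"
  obtain q i p S where qips: "c = (q, i, p, S)" by (cases c)
  have init: "q \<noteq> Init"
    using vrun_not_Init[of w "map command u"] by (simp add: c_def[symmetric] qips)
  from tm_run_represent[OF assms(1) order_refl, of w]
  obtain j where j: "tm_run verifier w u (Suc (length u)) = represent w u j c"
      "q \<notin> {Accept, Reject} \<longrightarrow> j = int (length u)"
    by (auto simp: c_def[symmetric] qips)
  have final: "fst (tm_run verifier w u (length u + 2))
      = (if q = Accept then code Accept else code Reject)"
  proof (cases "q \<in> {Accept, Reject}")
    case True
    then have "halted verifier (represent w u j c)"
      by (auto simp: qips halted_verifier_iff)
    then show ?thesis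
      using True j(1) tm_step_halted[of verifier "represent w u j c"] by (auto simp: tm_run_Suc qips)
  next
    case False
    have "fst (tape_of u) (int (length u)) = Blank"
      by (simp add: tape_of_def)
    from tm_step_represent_Blank[OF init _ _ this, of w i p S] False
    show ?thesis
      using j by (simp add: tm_run_Suc qips)
  qed
  have "halted verifier (tm_run verifier w u (length u + 2))"
    using final by (simp add: halted_def)
  from tm_run_halted[OF this assms(2)] final show ?thesis
    by (simp add: c_def[symmetric] qips)
qed

lemma halted_verifier:
  assumes "Blank \<notin> set u" "n \<ge> length u + 2"
  shows "halted verifier (tm_run verifier w u n)"
  using tm_run_verifier_final[OF assms] by (simp add: halted_def)

lemma tm_accepts_verifier_iff:
  assumes "Blank \<notin> set u"
  shows "tm_accepts verifier w u \<longleftrightarrow> fst (vrun w (map command u) vstart) = Accept"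
proof
  assume "tm_accepts verifier w u"
  then obtain n where n: "fst (tm_run verifier w u n) = code Accept"
    by (auto simp: tm_accepts_def)
  then have "halted verifier (tm_run verifier w u n)" by (simp add: halted_def)
  from tm_run_halted[OF this, of "n + (length u + 2)"] n
  have "fst (tm_run verifier w u (n + (length u + 2))) = code Accept" by simp
  with tm_run_verifier_final[OF assms, of "n + (length u + 2)" w]
  show "fst (vrun w (map command u) vstart) = Accept"
    by (simp split: if_splits)
next
  assume "fst (vrun w (map command u) vstart) = Accept"
  with tm_run_verifier_final[OF assms order_refl, of w] show "tm_accepts verifier w u"
    by (auto simp: tm_accepts_def)
qed

section \<open>Membership in NP\<close>

lemma certificates_verifier_iff:
  "u \<in> certificates verifier \<Longrightarrow> Blank \<notin> set u"
  "set ks \<subseteq> {..<5} \<Longrightarrow> map Aux ks \<in> certificates verifier"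
  by (auto simp: certificates_def tape_alphabet_def image_iff subset_iff)

lemma poly_cert_bound: "\<exists>p :: nat poly. \<forall>n. poly p n = cert_bound n"
proof -
  let ?n = "[:0, 1:] :: nat poly"
  let ?N = "2 * ?n * (?n + 1)"
  have "poly (?n + 1 + (?n + ?n * (2 * ?N + ?n)) + 1 + ?n
    + (2 * ?N + 1) * (?n + 1) * (2 * (?N + ?n) + ?n + (2 * ?n + 2)) + 1) n = cert_bound n" for n
    by (simp add: cert_bound_def algebra_simps)
  then show ?thesis by blast
qed

theorem solvable_words_in_NP: "{encode_words cs | cs. solvable cs} \<in> NP"
proof -
  obtain p :: "nat poly" where p: "\<And>n. poly p n = cert_bound n"
    using poly_cert_bound by blast
  \<comment> \<open>\<open>[:2, 1:]\<close> is X + 2: the certificate length plus the two extra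
    steps.\<close>
  have halts: "halted verifier (tm_run verifier w u (poly [:2, 1:] (length w + length u)))"
    if "u \<in> certificates verifier" for w u
    using certificates_verifier_iff(1)[OF that] by (intro halted_verifier) simp_all
  have "w \<in> {encode_words cs | cs. solvable cs} \<longleftrightarrow>
    (\<exists>u\<in>certificates verifier. length u \<le> poly p (length w) \<and> tm_accepts verifier w u)" for w
  proof
    assume "w \<in> {encode_words cs | cs. solvable cs}"
    then obtain ks where ks: "length ks \<le> cert_bound (length w)" "set ks \<subseteq> {..<5}"
        "fst (vrun w ks vstart) = Accept"
      using verifier_complete by blast
    let ?u = "map Aux ks :: letter option symbol list"
    have "map command ?u = ks" by (simp add: comp_def)
    then have "tm_accepts verifier w ?u"
      using ks(3) by (subst tm_accepts_verifier_iff) auto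
    then show "\<exists>u\<in>certificates verifier. length u \<le> poly p (length w) \<and> tm_accepts verifier w u"
      using ks by (intro bexI[of _ ?u] certificates_verifier_iff) (simp_all add: p)
  next
    assume "\<exists>u\<in>certificates verifier. length u \<le> poly p (length w) \<and> tm_accepts verifier w u"
    then obtain u where "u \<in> certificates verifier" "tm_accepts verifier w u" by blast
    then have "fst (vrun w (map command u) vstart) = Accept"
      using certificates_verifier_iff(1) tm_accepts_verifier_iff by blast
    then show "w \<in> {encode_words cs | cs. solvable cs}"
      using verifier_sound by blast
  qed
  with wf_verifier halts show ?thesis
    unfolding NP_def by blast
qed

theorem theorem5p7:
  "{encode_words cs | cs :: letter list list.
      \<exists>x \<in> carrier lamplighter. \<exists>zs.
        length zs = length cs \<and> set zs \<subseteq> carrier lamplighter \<and>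
        x [^]\<^bsub>lamplighter\<^esub> (2::nat) \<otimes>\<^bsub>lamplighter\<^esub>
          list_product lamplighter
            (map2 (\<lambda>z c. inv\<^bsub>lamplighter\<^esub> z \<otimes>\<^bsub>lamplighter\<^esub> word_value c \<otimes>\<^bsub>lamplighter\<^esub> z) zs cs)
        = \<one>\<^bsub>lamplighter\<^esub>} \<in> NP"
  using solvable_words_in_NP unfolding solvable_def .

end
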